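(* Let $X \subset \mathbb{R}^N$ be a compact set, let $\mu$ be a Borel probability measure on $X$ and let $T\colon X \to X$ be an injective Lipschitz map. Let $k \in \mathbb{N}$ satisfy $k > \dim_H \mu$ and assume $\dim_H(\mu|_{\mathrm{Per}_p(T)}) < p$ for $p = 1, \ldots, k-1$. Then for a prevalent set of Lipschitz observables $h \colon X \to \mathbb{R}$ (i.e. for all $h$ in a prevalent subset of $\mathrm{Lip}(X)$), the $k$-delay coordinate map $\phi_{h,k}$ is injective on a Borel set of full $\mu$-measure, and $\nu_{h,k}$-almost every point of $\mathbb{R}^k$ is predictable.
   Context: **Delay coordinate map.** For $T\colon X\to X$, $h \colon X \to \mathbb{R}$ and $k\in\mathbb{N}$, $\phi_{h,k}\colon X \to \mathbb{R}^k$ is $\phi_{h,k}(x) = (h(x), h(Tx), \ldots, h(T^{k-1}x))$, and $\nu_{h,k} = (\phi_{h,k})_*\mu$ is the push-forward of $\mu$. **Predictability.** Write $\phi = \phi_{h,k}$, $\nu = \nu_{h,k}$. For $y \in \operatorname{supp}\nu$ and $\varepsilon > 0$ put $$\chi_\varepsilon(y) = \frac{1}{\mu(\phi^{-1}(B(y,\varepsilon)))}\int_{\phi^{-1}(B(y,\varepsilon))} \phi(Tx)\,d\mu(x),$$ $$\sigma_\varepsilon(y) = \Big(\frac{1}{\mu(\phi^{-1}(B(y,\varepsilon)))}\int_{\phi^{-1}(B(y,\varepsilon))} \|\phi(Tx)-\chi_\varepsilon(y)\|^2\,d\mu(x)\Big)^{1/2},$$ where $B(y,\varepsilon)$ is the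 open ball, and $\sigma(y) = \lim_{\varepsilon\to0}\sigma_\varepsilon(y)$ if the limit exists. The point $y$ is predictable if $\sigma(y)$ exists and equals $0$. **Dimension.** For a finite Borel measure $\mu$ in $\mathbb{R}^N$, $\dim_H\mu = \inf\{\dim_H A : A\subset\mathbb{R}^N \text{ Borel of full } \mu\text{-measure}\}$, where $\dim_H A$ is the Hausdorff dimension of $A$. $\mathrm{Per}_p(T) = \{x\in X : T^px = x\}$. **Prevalence.** $\mathrm{Lip}(X)$ is the space of Lipschitz functions $h\colon X\to\mathbb{R}$ with norm $\|h\|_\infty + \mathrm{Lip}(h)$, where $\mathrm{Lip}(h)$ is the Lipschitz constant. A Borel subset $S$ of a normed space $V$ is prevalent if there is a Borel measure $\lambda$ on $V$, positive and finite on some compact set in $V$, such that for every $v\in V$ one has $v+e\in S$ for $\lambda$-almost every $e\in V$. A non-Borel subset is prevalent if it contains a prevalent Borel subset. *)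

theory Defs
  imports "HOL-Probability.Probability" "HOL-Library.Function_Algebras"
begin

text \<open>The value \<open>diam(U)^s\<close>, with the usual conventions for \<open>s = 0\<close>: \<open>0^0 = 1\<close> for nonempty sets
  (recall \<open>0 powr 0 = 0\<close>) and the empty set always contributes \<open>0\<close>.\<close>

definition diam_power :: "real \<Rightarrow> 'a::metric_space set \<Rightarrow> ennreal" where
  "diam_power s U = (if U = {} then 0 else if s = 0 then 1 else ennreal (diameter U powr s))"

text \<open>Boundedness is required explicitly, since \<^const>\<open>diameter\<close> is meaningless for unbounded sets.\<close>

definition hausdorff_premeasure :: "real \<Rightarrow> real \<Rightarrow> 'a::metric_space set \<Rightarrow> ennreal" where
  "hausdorff_premeasure s \<delta> A =
     (INF U \<in> {U :: nat \<Rightarrow> 'a set. A \<subseteq> (\<Union>i. U i) \<and> (\<forall>i. bounded (U i) \<and> diameter (U i) \<le> \<delta>)}.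
        \<Sum>i. diam_power s (U i))"

definition hausdorff_measure :: "real \<Rightarrow> 'a::metric_space set \<Rightarrow> ennreal" where
  "hausdorff_measure s A = (SUP \<delta> \<in> {0<..}. hausdorff_premeasure s \<delta> A)"

definition hausdorff_dim :: "'a::metric_space set \<Rightarrow> ereal" where
  "hausdorff_dim A = (INF s \<in> {s. 0 \<le> s \<and> hausdorff_measure s A = 0}. ereal s)"

text \<open>The measure \<open>M\<close> may live on a Borel subspace of the ambient space; it is then regarded as a
  measure on the whole space that vanishes off \<^term>\<open>space M\<close>. The sets \<open>A\<close> range over Borel subsets
  of the ambient space.\<close>

definition hausdorff_dim_measure :: "'a::metric_space measure \<Rightarrow> ereal" where
  "hausdorff_dim_measure M =
     (INF A \<in> {A. A \<in> sets borel \<and> emeasure M (space M - A) = 0}. hausdorff_dim A)"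

definition Per :: "nat \<Rightarrow> ('a \<Rightarrow> 'a) \<Rightarrow> 'a set \<Rightarrow> 'a set" where
  "Per p T X = {x \<in> X. (T ^^ p) x = x}"

text \<open>A function on \<open>X\<close> is represented by its extension by zero to the ambient type, which makes the
  representation unique and compatible with pointwise addition.\<close>

definition Lip_space :: "'a::metric_space set \<Rightarrow> ('a \<Rightarrow> real) set" where
  "Lip_space X = {h. (\<exists>L. L-lipschitz_on X h) \<and> (\<forall>x. x \<notin> X \<longrightarrow> h x = 0)}"

definition Lip_const :: "'a::metric_space set \<Rightarrow> ('a \<Rightarrow> real) \<Rightarrow> real" where
  "Lip_const X h = Inf {L. L-lipschitz_on X h}"

definition Lip_norm :: "'a::metric_space set \<Rightarrow> ('a \<Rightarrow> real) \<Rightarrow> real" where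
  "Lip_norm X h = (SUP x\<in>X. \<bar>h x\<bar>) + Lip_const X h"

text \<open>A normed space is given by a carrier \<open>V\<close>, closed under addition, and a norm function \<open>nrm\<close>
  on it. The distance is cut off outside \<open>V\<close> because \<^locale>\<open>Metric_space\<close> demands nonnegativity and
  symmetry for all arguments.\<close>

definition norm_dist :: "'v::ab_group_add set \<Rightarrow> ('v \<Rightarrow> real) \<Rightarrow> 'v \<Rightarrow> 'v \<Rightarrow> real" where
  "norm_dist V nrm u v = (if u \<in> V \<and> v \<in> V then nrm (u - v) else 0)"

definition norm_topology :: "'v::ab_group_add set \<Rightarrow> ('v \<Rightarrow> real) \<Rightarrow> 'v topology" where
  "norm_topology V nrm = Metric_space.mtopology V (norm_dist V nrm)"

definition norm_borel :: "'v::ab_group_add set \<Rightarrow> ('v \<Rightarrow> real) \<Rightarrow> 'v measure" where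
  "norm_borel V nrm = sigma V {U. openin (norm_topology V nrm) U}"

definition prevalent_borel :: "'v::ab_group_add set \<Rightarrow> ('v \<Rightarrow> real) \<Rightarrow> 'v set \<Rightarrow> bool" where
  "prevalent_borel V nrm S \<longleftrightarrow>
     S \<in> sets (norm_borel V nrm) \<and>
     (\<exists>\<Lambda>. sets \<Lambda> = sets (norm_borel V nrm) \<and>
          (\<exists>K. compactin (norm_topology V nrm) K \<and> 0 < emeasure \<Lambda> K \<and> emeasure \<Lambda> K < \<infinity>) \<and>
          (\<forall>v\<in>V. AE e in \<Lambda>. v + e \<in> S))"

definition prevalent :: "'v::ab_group_add set \<Rightarrow> ('v \<Rightarrow> real) \<Rightarrow> 'v set \<Rightarrow> bool" where
  "prevalent V nrm S \<longleftrightarrow>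
     S \<subseteq> V \<and>
     (if S \<in> sets (norm_borel V nrm) then prevalent_borel V nrm S
      else (\<exists>B. B \<subseteq> S \<and> prevalent_borel V nrm B))"

lemma prevalent_iff:
  "prevalent V nrm S \<longleftrightarrow> S \<subseteq> V \<and> (\<exists>B. B \<subseteq> S \<and> prevalent_borel V nrm B)"
proof -
  have "prevalent_borel V nrm S"
    if S: "S \<in> sets (norm_borel V nrm)" and B: "B \<subseteq> S" "prevalent_borel V nrm B" for B
  proof -
    from B(2) obtain \<Lambda> where "sets \<Lambda> = sets (norm_borel V nrm)"
      "\<exists>K. compactin (norm_topology V nrm) K \<and> 0 < emeasure \<Lambda> K \<and> emeasure \<Lambda> K < \<infinity>"
      and ae: "\<forall>v\<in>V. AE e in \<Lambda>. v + e \<in> B"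
      unfolding prevalent_borel_def by blast
    moreover have "\<forall>v\<in>V. AE e in \<Lambda>. v + e \<in> S"
    proof
      fix v assume "v \<in> V"
      with ae have "AE e in \<Lambda>. v + e \<in> B" by blast
      then show "AE e in \<Lambda>. v + e \<in> S" by eventually_elim (use B(1) in blast)
    qed
    ultimately show ?thesis unfolding prevalent_borel_def using S by blast
  qed
  then show ?thesis
    unfolding prevalent_def by (metis prevalent_borel_def subset_refl)
qed

lemma Lip_space_add:
  assumes "f \<in> Lip_space X" "g \<in> Lip_space X"
  shows "f + g \<in> Lip_space X"
proof -
  from assms obtain L M where "L-lipschitz_on X f" "M-lipschitz_on X g"
    unfolding Lip_space_def by blast
  from lipschitz_on_add[OF this] have "\<exists>K. K-lipschitz_on X (f + g)"
    unfolding plus_fun_def by (rule exI)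
  with assms show ?thesis by (simp add: Lip_space_def)
qed

lemma Lip_space_diff:
  assumes "f \<in> Lip_space X" "g \<in> Lip_space X"
  shows "f - g \<in> Lip_space X"
proof -
  from assms obtain L M where "L-lipschitz_on X f" "M-lipschitz_on X g"
    unfolding Lip_space_def by blast
  from lipschitz_on_diff[OF this] have "\<exists>K. K-lipschitz_on X (f - g)"
    unfolding fun_diff_def by (rule exI)
  with assms show ?thesis by (simp add: Lip_space_def)
qed

lemma Lip_const_lipschitz_on:
  assumes "h \<in> Lip_space X"
  shows "(Lip_const X h)-lipschitz_on X h"
proof -
  let ?S = "{L. L-lipschitz_on X h}"
  have ne: "?S \<noteq> {}" using assms by (auto simp: Lip_space_def)
  have nn: "0 \<le> Inf ?S"
    by (rule cInf_greatest[OF ne]) (auto dest: lipschitz_on_nonneg)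
  have "dist (h x) (h y) \<le> Inf ?S * dist x y" if "x \<in> X" "y \<in> X" for x y
  proof (cases "x = y")
    case False
    then have d: "dist x y > 0" by simp
    have "dist (h x) (h y) / dist x y \<le> Inf ?S"
      by (rule cInf_greatest[OF ne])
        (use d that in \<open>auto simp: pos_divide_le_eq dest: lipschitz_onD\<close>)
    then show ?thesis using d by (simp add: pos_divide_le_eq)
  qed simp
  with nn show ?thesis by (simp add: Lip_const_def lipschitz_on_def)
qed

lemma Lip_const_le:
  assumes "L-lipschitz_on X h"
  shows "Lip_const X h \<le> L"
  unfolding Lip_const_def
  by (rule cInf_lower) (use assms in \<open>auto intro!: bdd_belowI[of _ 0] dest: lipschitz_on_nonneg\<close>)

lemma Lip_space_bdd:
  assumes "compact X" "h \<in> Lip_space X"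
  shows "bdd_above ((\<lambda>x. \<bar>h x\<bar>) ` X)"
proof -
  have "continuous_on X (\<lambda>x. \<bar>h x\<bar>)"
    using Lip_const_lipschitz_on[OF assms(2)] lipschitz_on_continuous_on
    by (blast intro: continuous_on_rabs)
  from compact_continuous_image[OF this assms(1)] show ?thesis
    by (simp add: bounded_imp_bdd_above compact_imp_bounded)
qed

lemma Metric_space_Lip_space:
  assumes X: "compact X" "X \<noteq> {}"
  shows "Metric_space (Lip_space X) (norm_dist (Lip_space X) (Lip_norm X))"
proof -
  have nonneg: "0 \<le> Lip_const X h" "0 \<le> (SUP x\<in>X. \<bar>h x\<bar>)" if "h \<in> Lip_space X" for h
  proof -
    show "0 \<le> Lip_const X h" using Lip_const_lipschitz_on[OF that] by (rule lipschitz_on_nonneg)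
    obtain x where "x \<in> X" using X by blast
    from cSUP_upper[OF this Lip_space_bdd[OF X(1) that]]
    show "0 \<le> (SUP x\<in>X. \<bar>h x\<bar>)" by linarith
  qed
  have tri: "Lip_norm X (f + g) \<le> Lip_norm X f + Lip_norm X g"
    if fg: "f \<in> Lip_space X" "g \<in> Lip_space X" for f g
  proof -
    have "(SUP x\<in>X. \<bar>(f + g) x\<bar>) \<le> (SUP x\<in>X. \<bar>f x\<bar>) + (SUP x\<in>X. \<bar>g x\<bar>)"
    proof (rule cSUP_least[OF X(2)])
      fix x assume x: "x \<in> X"
      have "\<bar>(f + g) x\<bar> \<le> \<bar>f x\<bar> + \<bar>g x\<bar>" by simp
      then show "\<bar>(f + g) x\<bar> \<le> (SUP x\<in>X. \<bar>f x\<bar>) + (SUP x\<in>X. \<bar>g x\<bar>)"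
        using cSUP_upper[OF x Lip_space_bdd[OF X(1) fg(1)]]
          cSUP_upper[OF x Lip_space_bdd[OF X(1) fg(2)]] by linarith
    qed
    moreover have "Lip_const X (f + g) \<le> Lip_const X f + Lip_const X g"
      by (rule Lip_const_le)
        (unfold plus_fun_def, intro lipschitz_on_add Lip_const_lipschitz_on fg)
    ultimately show ?thesis by (simp add: Lip_norm_def)
  qed
  have minus: "Lip_norm X (f - g) = Lip_norm X (g - f)" for f g
  proof -
    have "dist (f x - g x) (f y - g y) = dist (g x - f x) (g y - f y)" for x y
      unfolding dist_real_def by arith
    then show ?thesis
      unfolding Lip_norm_def Lip_const_def lipschitz_on_def fun_diff_def
      by (subst abs_minus_commute) simp
  qed
  have zero: "Lip_norm X h = 0 \<longleftrightarrow> h = 0" if h: "h \<in> Lip_space X" for h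
  proof
    assume "Lip_norm X h = 0"
    with nonneg[OF h] have s: "(SUP x\<in>X. \<bar>h x\<bar>) = 0" by (simp add: Lip_norm_def)
    have "h x = 0" for x
    proof (cases "x \<in> X")
      case True
      from cSUP_upper[OF this Lip_space_bdd[OF X(1) h]] s show ?thesis by simp
    qed (use h in \<open>simp add: Lip_space_def\<close>)
    then show "h = 0" by (simp add: fun_eq_iff)
  next
    assume h0: "h = 0"
    have "Lip_const X h \<le> 0" by (rule Lip_const_le) (simp add: h0 lipschitz_on_def)
    with nonneg(1)[OF h] show "Lip_norm X h = 0" using X(2) by (simp add: Lip_norm_def h0)
  qed
  show ?thesis
  proof
    show "0 \<le> norm_dist (Lip_space X) (Lip_norm X) f g" for f g
      using nonneg[OF Lip_space_diff, of f g] by (simp add: norm_dist_def Lip_norm_def)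
    show "norm_dist (Lip_space X) (Lip_norm X) f g = norm_dist (Lip_space X) (Lip_norm X) g f" for f g
      using minus[of f g] by (simp add: norm_dist_def)
    show "norm_dist (Lip_space X) (Lip_norm X) f g = 0 \<longleftrightarrow> f = g"
      if "f \<in> Lip_space X" "g \<in> Lip_space X" for f g
      using zero[OF Lip_space_diff[OF that]] that by (simp add: norm_dist_def)
    show "norm_dist (Lip_space X) (Lip_norm X) f h \<le>
        norm_dist (Lip_space X) (Lip_norm X) f g + norm_dist (Lip_space X) (Lip_norm X) g h"
      if "f \<in> Lip_space X" "g \<in> Lip_space X" "h \<in> Lip_space X" for f g h
      using tri[OF Lip_space_diff[OF that(1,2)] Lip_space_diff[OF that(2,3)]] that
      by (simp add: norm_dist_def)
  qed
qed

text \<open>\<open>idx\<close> is meant to be a bijection from the index type onto \<open>{..<k}\<close>; it numbers the coordinates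
  of the \<open>k\<close>-dimensional space \<open>real ^ 'k\<close>, so that coordinate number \<open>j\<close> of the value is
  \<open>h (T\<^sup>j x)\<close>.\<close>

definition delay_map :: "('k::finite \<Rightarrow> nat) \<Rightarrow> ('a \<Rightarrow> 'a) \<Rightarrow> ('a \<Rightarrow> real) \<Rightarrow> 'a \<Rightarrow> real ^ 'k" where
  "delay_map idx T h x = (\<chi> i. h ((T ^^ idx i) x))"

definition measure_supp :: "'b::metric_space measure \<Rightarrow> 'b set" where
  "measure_supp \<nu> = {y. \<forall>\<epsilon>>0. emeasure \<nu> (ball y \<epsilon>) > 0}"

context
  fixes \<mu> :: "'a measure" and T :: "'a \<Rightarrow> 'a" and \<phi> :: "'a \<Rightarrow> 'b::euclidean_space"
begin

definition prediction_mean :: "real \<Rightarrow> 'b \<Rightarrow> 'b" where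
  "prediction_mean \<epsilon> y =
     (1 / measure \<mu> (\<phi> -` ball y \<epsilon> \<inter> space \<mu>)) *\<^sub>R
     (LINT x : \<phi> -` ball y \<epsilon> \<inter> space \<mu> | \<mu>. \<phi> (T x))"

definition prediction_error :: "real \<Rightarrow> 'b \<Rightarrow> real" where
  "prediction_error \<epsilon> y =
     sqrt ((1 / measure \<mu> (\<phi> -` ball y \<epsilon> \<inter> space \<mu>)) *
           (LINT x : \<phi> -` ball y \<epsilon> \<inter> space \<mu> | \<mu>. (norm (\<phi> (T x) - prediction_mean \<epsilon> y))\<^sup>2))"

definition predictable :: "'b \<Rightarrow> bool" where
  "predictable y \<longleftrightarrow>
     y \<in> measure_supp (distr \<mu> borel \<phi>) \<and> ((\<lambda>\<epsilon>. prediction_error \<epsilon> y) \<longlongrightarrow> 0) (at_right 0)"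

end

end

theory Submission
  imports Defs
begin

text \<open>
  Fix \<open>x\<close> and perturb an observable by a random series \<open>\<Sum>j. \<alpha>\<^sub>j p\<^sub>j\<close> of small bump functions. If the
  first \<open>q\<close> iterates of \<open>y\<close> are distinct and avoid those of \<open>x\<close>, then \<open>q\<close> of the bumps isolate the
  iterates of \<open>y\<close>, so a collision of the delay vectors of \<open>x\<close> and \<open>y\<close> prescribes the \<open>q\<close> corresponding
  coefficients as a Lipschitz function of \<open>y\<close>, given the other coefficients. As \<open>y\<close> runs through a set
  of Hausdorff measure \<open>H\<^sup>q = 0\<close>, these values form a null set. Here \<open>q = k\<close> unless \<open>y\<close> has a smaller
  minimal period, which is then taken for \<open>q\<close>; the finitely many \<open>y\<close> whose iterates meet those of \<open>x\<close>
  are treated one by one with \<open>q = 1\<close>. Fubini's theorem turns this into almost sure injectivity.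

  If \<open>\<phi>\<close> is injective on a \<open>\<sigma>\<close>-compact set of full measure, then almost every value \<open>\<phi> x\<close> is a density
  point of the \<open>\<phi>\<close>-image of every set, from a countable family, that contains \<open>x\<close> and on which \<open>\<phi> \<circ> T\<close>
  varies little. This is the differentiation theorem for arbitrary finite Borel measures and makes
  the prediction error vanish.
\<close>

section \<open>Besicovitch differentiation\<close>

text \<open>Fixing \<open>x\<close> is what lets \<open>k > dim\<close> suffice: only one point
  moves, so k independent coefficients face a set with H^k = 0, while moving both points would cost
  about twice the dimension. The price is that the exceptional coefficients depend on
  \<open>x\<close>, and exchanging the quantifiers needs measurability of the collision set jointly
  in the point and the coefficients. That set is a projection, and the good observables have to form
  a Borel set in the norm of Lip(X); neither is automatic. Hence \<open>y\<close> is confined to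
  compact sets of nearly full measure and kept at distance at least 1/(m+1) from \<open>x\<close>.
  Collision sets then become closed, their measure is upper semicontinuous in the observable, and
  the good observables are a countable intersection of open sets. Compactness also makes the image
  sets in the predictability part Borel. A point of minimal period q shows only q distinct values of
  an observable, so only q coefficients can work against it; this is what the dimension bounds on
  periodic points pay for. The measure on the delay space is not known to be doubling, which rules
  out a Vitali argument for its density points.\<close>

lemma norm_sgn_diff_ge_1:
  fixes a b :: "'a::real_inner"
  assumes "a \<noteq> 0" "b \<noteq> 0" "norm a \<le> norm (a - b)" "norm b \<le> norm (a - b)"
  shows "1 \<le> norm (sgn a - sgn b)"
proof -
  \<comment> \<open>Law of cosines: if the third side is at least as long as the longer of
    \<open>a\<close> and \<open>b\<close>, the angle between them is at least 60 degrees, and then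
    the unit vectors are at distance at least 1.\<close>
  have *: "2 * (a \<bullet> b) \<le> norm a * norm b"
    if "norm b \<le> norm a" "norm a \<le> norm (a - b)" for a b :: 'a
  proof -
    have "(norm a)\<^sup>2 \<le> (norm (a - b))\<^sup>2"
      using that(2) by (simp add: power_mono)
    moreover have "(norm (a - b))\<^sup>2 = (norm a)\<^sup>2 + (norm b)\<^sup>2 - 2 * (a \<bullet> b)"
      by (simp add: power2_norm_eq_inner inner_diff_left inner_diff_right inner_commute)
    ultimately have "2 * (a \<bullet> b) \<le> norm b * norm b"
      by (simp add: power2_eq_square)
    also have "\<dots> \<le> norm a * norm b"
      using that(1) by (simp add: mult_right_mono)
    finally show ?thesis .
  qed
  have "2 * (a \<bullet> b) \<le> norm a * norm b"
    using *[of a b] *[of b a] assms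
    by (metis inner_commute linorder_linear mult.commute norm_minus_commute)
  then have "2 * (sgn a \<bullet> sgn b) \<le> 1"
    using assms(1,2) by (simp add: sgn_div_norm field_simps)
  moreover have "sgn a \<bullet> sgn a = 1" "sgn b \<bullet> sgn b = 1"
    using assms(1,2) by (simp_all add: dot_square_norm norm_sgn)
  ultimately have "1 \<le> (norm (sgn a - sgn b))\<^sup>2"
    by (simp add: power2_norm_eq_inner inner_diff_left inner_diff_right inner_commute)
  then show ?thesis
    using abs_le_square_iff[of 1 "norm (sgn a - sgn b)"] by simp
qed

text \<open>A ball of radius \<open>\<rho>/2\<close> holds at most one point of a
  \<open>\<rho>\<close>-separated set, so the size of one finite cover of \<open>K\<close> bounds
  all such sets at once.\<close>

lemma separated_card_bound:
  fixes K :: "'a::euclidean_space set"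
  assumes "bounded K" "0 < \<rho>"
  obtains C :: nat where
    "\<And>S. S \<subseteq> K \<Longrightarrow> (\<And>x y. x \<in> S \<Longrightarrow> y \<in> S \<Longrightarrow> x \<noteq> y \<Longrightarrow> \<rho> \<le> dist x y) \<Longrightarrow> finite S \<and> card S \<le> C"
proof -
  have "compact (closure K)" using assms(1) by simp
  then obtain F where F: "finite F" "closure K \<subseteq> (\<Union>c\<in>F. ball c (\<rho>/2))"
  proof (rule compactE_image[of "closure K" "closure K" "\<lambda>c. ball c (\<rho>/2)"])
    show "closure K \<subseteq> (\<Union>c\<in>closure K. ball c (\<rho>/2))" using assms(2) by force
  qed auto
  have "finite S \<and> card S \<le> card F"
    if S: "S \<subseteq> K" and sep: "\<And>x y. x \<in> S \<Longrightarrow> y \<in> S \<Longrightarrow> x \<noteq> y \<Longrightarrow> \<rho> \<le> dist x y" for S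
  proof -
    have "\<forall>x\<in>S. \<exists>c\<in>F. x \<in> ball c (\<rho>/2)"
      using S F(2) closure_subset by blast
    then obtain c where c: "\<And>x. x \<in> S \<Longrightarrow> c x \<in> F \<and> dist (c x) x < \<rho>/2"
      by (metis mem_ball)
    have inj: "inj_on c S"
    proof (rule inj_onI, rule ccontr)
      fix x y assume xy: "x \<in> S" "y \<in> S" "c x = c y" "x \<noteq> y"
      have "dist x y \<le> dist (c x) x + dist (c x) y"
        by (metis dist_commute dist_triangle)
      with c[OF xy(1)] c[OF xy(2)] sep[OF xy(1,2,4)] xy(3) show False by simp
    qed
    show ?thesis
    proof
      have sub: "c ` S \<subseteq> F" using c by blast
      show "finite S" using inj sub F(1) by (rule inj_on_finite)
      show "card S \<le> card F" using inj sub F(1) by (rule card_inj_on_le)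
    qed
  qed
  then show thesis using that by blast
qed

text \<open>If \<open>z\<close> lies in two of the balls, the segment between the centres is a longest side of the
  triangle with vertex \<open>z\<close>, so the directions from \<open>z\<close> to the centres are separated on the unit
  sphere.\<close>

lemma ball_overlap_bound:
  "\<exists>C :: nat. \<forall>S (r :: 'a::euclidean_space \<Rightarrow> real) z.
     (\<forall>x\<in>S. \<forall>y\<in>S. x \<noteq> y \<longrightarrow> max (r x) (r y) \<le> dist x y) \<longrightarrow>
     card {x \<in> S. z \<in> ball x (r x)} \<le> C"
proof -
  obtain C :: nat where C: "\<And>S. S \<subseteq> sphere (0::'a) 1 \<Longrightarrow>
      (\<And>x y. x \<in> S \<Longrightarrow> y \<in> S \<Longrightarrow> x \<noteq> y \<Longrightarrow> 1 \<le> dist x y) \<Longrightarrow> finite S \<and> card S \<le> C"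
    by (rule separated_card_bound[of "sphere (0::'a) 1" 1]) (simp_all, blast)
  have "card {x \<in> S. z \<in> ball x (r x)} \<le> max 1 C"
    if sep: "\<forall>x\<in>S. \<forall>y\<in>S. x \<noteq> y \<longrightarrow> max (r x) (r y) \<le> dist x y"
    for S and r :: "'a \<Rightarrow> real" and z
  proof (cases "z \<in> {x \<in> S. z \<in> ball x (r x)}")
    \<comment> \<open>If \<open>z\<close> is itself a centre, its direction from \<open>z\<close> is
      undefined. But every other centre is then at least its own radius away from \<open>z\<close>,
      so no other open ball contains \<open>z\<close>.\<close>
    case True
    then have "{x \<in> S. z \<in> ball x (r x)} \<subseteq> {z}"
      using sep by (force simp: max_def split: if_splits)
    then have "card {x \<in> S. z \<in> ball x (r x)} \<le> 1"
      by (metis card.empty card.insert empty_iff finite.emptyI subset_singletonD le0 One_nat_def order_refl)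
    then show ?thesis by simp
  next
    case False
    let ?Q = "{x \<in> S. z \<in> ball x (r x)}"
    define u where "u = (\<lambda>x. sgn (x - z))"
    have u: "1 \<le> dist (u x) (u y)" if "x \<in> ?Q" "y \<in> ?Q" "x \<noteq> y" for x y
    proof -
      have "norm (x - z) < r x" "norm (y - z) < r y" using that by (auto simp: dist_norm)
      moreover have "max (r x) (r y) \<le> dist x y" using sep that by blast
      ultimately have "norm (x - z) \<le> dist x y" "norm (y - z) \<le> dist x y" by auto
      then show ?thesis
        unfolding u_def dist_norm using that False
        by (intro norm_sgn_diff_ge_1) auto
    qed
    have inj: "inj_on u ?Q"
    proof (rule inj_onI, rule ccontr)
      fix x y assume "x \<in> ?Q" "y \<in> ?Q" "u x = u y" "x \<noteq> y"
      with u[of x y] show False by simp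
    qed
    have "u ` ?Q \<subseteq> sphere 0 1"
      using False by (auto simp: u_def norm_sgn)
    then have "card (u ` ?Q) \<le> C"
    proof -
      have "1 \<le> dist a b" if ab: "a \<in> u ` ?Q" "b \<in> u ` ?Q" "a \<noteq> b" for a b
      proof -
        from ab obtain x y where "x \<in> ?Q" "y \<in> ?Q" "a = u x" "b = u y" by (elim imageE)
        with u[of x y] ab(3) show ?thesis by fastforce
      qed
      with C[of "u ` ?Q"] \<open>u ` ?Q \<subseteq> sphere 0 1\<close> show ?thesis by blast
    qed
    then show ?thesis using card_image[OF inj] by simp
  qed
  then show ?thesis by blast
qed

text \<open>Cardinalities of separated subsets are bounded, so one of greatest size exists without
  Zorn's lemma; a point left uncovered could be added to it.\<close>

lemma maximal_separated_subset:
  fixes K :: "'a::euclidean_space set"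
  assumes "bounded K" "0 < \<rho>"
  obtains S where "finite S" "S \<subseteq> K" "K \<subseteq> (\<Union>x\<in>S. ball x \<rho>)"
    "\<And>x y. x \<in> S \<Longrightarrow> y \<in> S \<Longrightarrow> x \<noteq> y \<Longrightarrow> \<rho> \<le> dist x y"
proof -
  define P where "P S \<longleftrightarrow> S \<subseteq> K \<and> (\<forall>x\<in>S. \<forall>y\<in>S. x \<noteq> y \<longrightarrow> \<rho> \<le> dist x y)" for S
  obtain C :: nat where C: "\<And>S. P S \<Longrightarrow> finite S \<and> card S \<le> C"
    using separated_card_bound[OF assms] unfolding P_def by (smt (verit, best))
  have "P {}" by (simp add: P_def)
  then obtain S where S: "P S" and max: "\<And>S'. P S' \<Longrightarrow> card S' \<le> card S"
    using ex_has_greatest_nat[of P "{}" card "Suc C"] C by (auto simp: less_Suc_eq_le)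
  have "y \<in> (\<Union>x\<in>S. ball x \<rho>)" if y: "y \<in> K" for y
  proof (rule ccontr)
    assume n: "y \<notin> (\<Union>x\<in>S. ball x \<rho>)"
    then have "y \<notin> S" using assms(2) by auto
    moreover have "P (insert y S)"
      using S y n unfolding P_def by (auto simp: not_less dist_commute)
    ultimately show False using max[of "insert y S"] C[OF S] by simp
  qed
  with S C[OF S] show thesis
    by (intro that[of S]) (auto simp: P_def)
qed

text \<open>Greedy choice by decreasing radius, as an induction that removes the largest radius
  \<open>\<rho>\<close>: a maximal separated set of centres with radius \<open>\<rho>\<close> is
  taken, the points it covers are discarded, and the rest is left to the smaller radii. Later
  centres lie outside the earlier, larger balls, which gives the bound with
  \<open>max\<close>.\<close>

lemma besicovitch_selection:
  fixes K :: "'a::euclidean_space set"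
  assumes "bounded K" "finite R" "r ` K \<subseteq> R" "\<And>x. x \<in> K \<Longrightarrow> 0 < r x"
  shows "\<exists>S. finite S \<and> S \<subseteq> K \<and> K \<subseteq> (\<Union>x\<in>S. ball x (r x)) \<and>
    (\<forall>x\<in>S. \<forall>y\<in>S. x \<noteq> y \<longrightarrow> max (r x) (r y) \<le> dist x y)"
  using assms(2,1,3,4)
proof (induction R arbitrary: K rule: finite_linorder_max_induct)
  case empty
  then show ?case by (intro exI[of _ "{}"]) auto
next
  case (insert \<rho> R)
  let ?K1 = "{x \<in> K. r x = \<rho>}"
  show ?case
  proof (cases "?K1 = {}")
    case True
    then have "r ` K \<subseteq> R" using insert.prems(2) by auto
    with insert.prems(1,3) show ?thesis by (intro insert.IH) auto
  next
    case False
    then have "0 < \<rho>" using insert.prems by auto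
    moreover have "bounded ?K1" by (rule bounded_subset[OF insert.prems(1)]) auto
    ultimately obtain S1 where S1: "finite S1" "S1 \<subseteq> ?K1" "?K1 \<subseteq> (\<Union>x\<in>S1. ball x \<rho>)"
      "\<And>x y. x \<in> S1 \<Longrightarrow> y \<in> S1 \<Longrightarrow> x \<noteq> y \<Longrightarrow> \<rho> \<le> dist x y"
      using maximal_separated_subset[of ?K1 \<rho>] by (smt (verit, best))
    let ?K2 = "K - (\<Union>x\<in>S1. ball x \<rho>)"
    have "r ` ?K2 \<subseteq> R" using insert.prems(2) S1(3) by auto
    moreover have "bounded ?K2" by (rule bounded_subset[OF insert.prems(1)]) auto
    moreover have "\<And>x. x \<in> ?K2 \<Longrightarrow> 0 < r x" using insert.prems(3) by blast
    ultimately have "\<exists>S. finite S \<and> S \<subseteq> ?K2 \<and> ?K2 \<subseteq> (\<Union>x\<in>S. ball x (r x)) \<and>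
        (\<forall>x\<in>S. \<forall>y\<in>S. x \<noteq> y \<longrightarrow> max (r x) (r y) \<le> dist x y)"
      by (intro insert.IH)
    then obtain S2 where S2: "finite S2" "S2 \<subseteq> ?K2" "?K2 \<subseteq> (\<Union>x\<in>S2. ball x (r x))"
      "\<forall>x\<in>S2. \<forall>y\<in>S2. x \<noteq> y \<longrightarrow> max (r x) (r y) \<le> dist x y"
      by (elim exE conjE)
    have cross: "max (r x) (r y) \<le> dist x y" if "x \<in> S1" "y \<in> S2" for x y
    proof -
      have "r x = \<rho>" "\<rho> \<le> dist x y" using that S1(2) S2(2) by (auto simp: not_less)
      moreover have "r y \<in> R"
        using that S2(2) \<open>r ` ?K2 \<subseteq> R\<close> by blast
      then have "r y < \<rho>" using insert.hyps(2) by blast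
      ultimately show ?thesis by simp
    qed
    have "K \<subseteq> (\<Union>x\<in>S1 \<union> S2. ball x (r x))"
    proof
      fix y assume "y \<in> K"
      then consider "y \<in> (\<Union>x\<in>S1. ball x \<rho>)" | "y \<in> ?K2" by blast
      then show "y \<in> (\<Union>x\<in>S1 \<union> S2. ball x (r x))"
      proof cases
        case 1
        then obtain x where "x \<in> S1" "y \<in> ball x \<rho>" by blast
        moreover from this S1(2) have "r x = \<rho>" by blast
        ultimately show ?thesis by blast
      next
        case 2
        with S2(3) show ?thesis by blast
      qed
    qed
    moreover have "max (r x) (r y) \<le> dist x y" if "x \<in> S1 \<union> S2" "y \<in> S1 \<union> S2" "x \<noteq> y" for x y
    proof -
      have "r x = \<rho>" if "x \<in> S1" for x using that S1(2) by auto
      with that cross[of x y] cross[of y x] S1(4)[of x y] S2(4) show ?thesis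
        by (auto simp: dist_commute max.commute)
    qed
    ultimately show ?thesis
      using S1(1,2) S2(1,2) by (intro exI[of _ "S1 \<union> S2"]) auto
  qed
qed

section \<open>The centred maximal function and its weak-type inequality\<close>

lemma ball_eq_UN_ball:
  fixes y :: "'a::metric_space"
  shows "ball y r = (\<Union>n. ball y (r - 1 / real (Suc n)))"
proof
  show "ball y r \<subseteq> (\<Union>n. ball y (r - 1 / real (Suc n)))"
  proof
    fix x assume "x \<in> ball y r"
    then obtain n where "1 / real (Suc n) < r - dist y x"
      using nat_approx_posE[of "r - dist y x"] by (auto simp: field_simps)
    then show "x \<in> (\<Union>n. ball y (r - 1 / real (Suc n)))" by (auto intro!: exI[of _ n])
  qed
  show "(\<Union>n. ball y (r - 1 / real (Suc n))) \<subseteq> ball y r"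
  proof
    fix x assume "x \<in> (\<Union>n. ball y (r - 1 / real (Suc n)))"
    then obtain n where "dist y x < r - 1 / real (Suc n)" by auto
    moreover have "0 < 1 / real (Suc n)" by simp
    ultimately have "dist y x < r" by linarith
    then show "x \<in> ball y r" by simp
  qed
qed

lemma shrink_ball_measure:
  fixes \<nu> :: "'a::metric_space measure"
  assumes [measurable_cong]: "sets \<nu> = sets borel" and H[measurable]: "H \<in> sets borel"
    and "c < emeasure \<nu> (ball y r \<inter> H)"
  obtains s where "s < r" "c < emeasure \<nu> (ball y s \<inter> H)"
proof -
  define B where "B = (\<lambda>n. ball y (r - 1 / real (Suc n)) \<inter> H)"
  have "incseq B"
    unfolding B_def
  proof (rule incseq_SucI)
    fix n
    have "1 / real (Suc (Suc n)) \<le> 1 / real (Suc n)" by (simp add: frac_le)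
    then have "r - 1 / real (Suc n) \<le> r - 1 / real (Suc (Suc n))" by simp
    from subset_ball[OF this]
    show "ball y (r - 1 / real (Suc n)) \<inter> H \<subseteq> ball y (r - 1 / real (Suc (Suc n))) \<inter> H"
      by blast
  qed
  moreover have "range B \<subseteq> sets \<nu>" unfolding B_def by auto
  ultimately have "(SUP n. emeasure \<nu> (B n)) = emeasure \<nu> (\<Union>n. B n)"
    by (intro SUP_emeasure_incseq)
  also have "(\<Union>n. B n) = ball y r \<inter> H"
    unfolding B_def by (subst (2) ball_eq_UN_ball) blast
  finally have "c < (SUP n. emeasure \<nu> (B n))" using assms(3) by simp
  then obtain n where "c < emeasure \<nu> (B n)" by (auto simp: less_SUP_iff)
  then show thesis by (intro that[of "r - 1 / real (Suc n)"]) (auto simp: B_def)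
qed

text \<open>The superlevel set, at height \<open>\<kappa>\<close>, of the centred maximal function
  of the indicator of \<open>H\<close> with respect to \<open>\<nu>\<close>, written without
  division so that null balls need no convention.\<close>

definition max_set :: "'a::metric_space measure \<Rightarrow> real \<Rightarrow> 'a set \<Rightarrow> 'a set" where
  "max_set \<nu> \<kappa> H = {y. \<exists>r>0. ennreal \<kappa> * emeasure \<nu> (ball y r) < emeasure \<nu> (ball y r \<inter> H)}"

text \<open>Strictness leaves room: the inequality survives if \<open>H\<close> is only measured in
  a smaller concentric ball. A ball of intermediate radius about a nearby centre lies between the
  two. A radius shared by all nearby centres leaves only finitely many radii once a finite subcover
  is taken.\<close>

lemma max_set_locally_uniform:
  fixes \<nu> :: "'a::metric_space measure"
  assumes [measurable_cong]: "sets \<nu> = sets borel" and H[measurable]: "H \<in> sets borel"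
    and "y \<in> max_set \<nu> \<kappa> H"
  obtains \<delta> \<rho> where "0 < \<delta>" "0 < \<rho>" "\<And>x. x \<in> ball y \<delta> \<Longrightarrow>
    ennreal \<kappa> * emeasure \<nu> (ball x \<rho>) < emeasure \<nu> (ball x \<rho> \<inter> H)"
proof -
  from assms(3) obtain r where r: "0 < r"
      "ennreal \<kappa> * emeasure \<nu> (ball y r) < emeasure \<nu> (ball y r \<inter> H)"
    unfolding max_set_def by blast
  obtain s where s: "s < r" "ennreal \<kappa> * emeasure \<nu> (ball y r) < emeasure \<nu> (ball y s \<inter> H)"
    using shrink_ball_measure[OF assms(1,2) r(2)] by blast
  have "ball y s \<inter> H \<noteq> {}" using s(2) by auto
  then have "0 < s" by (metis Int_empty_left ball_eq_empty not_less)
  show thesis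
  proof (rule that[of "(r - s) / 2" "(r + s) / 2"])
    fix x assume "x \<in> ball y ((r - s) / 2)"
    then have d: "dist y x < (r - s) / 2" "dist x y < (r - s) / 2" by (auto simp: dist_commute)
    have sub: "ball y s \<subseteq> ball x ((r + s) / 2)" "ball x ((r + s) / 2) \<subseteq> ball y r"
    proof -
      show "ball y s \<subseteq> ball x ((r + s) / 2)"
      proof
        fix z assume "z \<in> ball y s"
        then show "z \<in> ball x ((r + s) / 2)" using dist_triangle[of x z y] d by (simp add: field_simps)
      qed
      show "ball x ((r + s) / 2) \<subseteq> ball y r"
      proof
        fix z assume "z \<in> ball x ((r + s) / 2)"
        then show "z \<in> ball y r" using dist_triangle[of y z x] d by (simp add: field_simps)
      qed
    qed
    have "ennreal \<kappa> * emeasure \<nu> (ball x ((r + s) / 2)) \<le> ennreal \<kappa> * emeasure \<nu> (ball y r)"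
      using sub(2) by (intro mult_left_mono emeasure_mono) (auto simp: assms(1))
    also note s(2)
    also have "emeasure \<nu> (ball y s \<inter> H) \<le> emeasure \<nu> (ball x ((r + s) / 2) \<inter> H)"
      using sub(1) by (intro emeasure_mono) (auto simp: assms(1))
    finally show "ennreal \<kappa> * emeasure \<nu> (ball x ((r + s) / 2))
        < emeasure \<nu> (ball x ((r + s) / 2) \<inter> H)" .
  qed (use \<open>0 < s\<close> s(1) in auto)
qed

lemma open_max_set:
  fixes \<nu> :: "'a::metric_space measure"
  assumes "sets \<nu> = sets borel" and "H \<in> sets borel"
  shows "open (max_set \<nu> \<kappa> H)"
proof (rule openI)
  fix y assume "y \<in> max_set \<nu> \<kappa> H"
  from max_set_locally_uniform[OF assms this] obtain \<delta> \<rho> where \<delta>: "0 < \<delta>" "0 < \<rho>"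
    "\<And>x. x \<in> ball y \<delta> \<Longrightarrow> ennreal \<kappa> * emeasure \<nu> (ball x \<rho>) < emeasure \<nu> (ball x \<rho> \<inter> H)"
    by blast
  then have "ball y \<delta> \<subseteq> max_set \<nu> \<kappa> H" unfolding max_set_def by blast
  with \<delta>(1) show "\<exists>e>0. ball y e \<subseteq> max_set \<nu> \<kappa> H" by blast
qed

text \<open>Enlarged balls are not controlled by an arbitrary measure. The selected balls cover
  \<open>K\<close> without enlargement, and their bounded overlap \<open>C\<close> replaces
  disjointness: the indicators of their intersections with \<open>H\<close> add up to at most
  \<open>C\<close> times the indicator of \<open>H\<close>.\<close>

lemma compact_max_set_bound:
  fixes \<nu> :: "'a::euclidean_space measure"
  assumes sets[measurable_cong]: "sets \<nu> = sets borel" and H[measurable]: "H \<in> sets borel"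
    and K: "compact K" "K \<subseteq> max_set \<nu> \<kappa> H"
    and C: "\<forall>S (r :: 'a \<Rightarrow> real) z.
       (\<forall>x\<in>S. \<forall>y\<in>S. x \<noteq> y \<longrightarrow> max (r x) (r y) \<le> dist x y) \<longrightarrow>
       card {x \<in> S. z \<in> ball x (r x)} \<le> C"
  shows "ennreal \<kappa> * emeasure \<nu> K \<le> of_nat C * emeasure \<nu> H"
proof -
  have "\<exists>\<delta> \<rho>. 0 < \<delta> \<and> 0 < \<rho> \<and> (\<forall>x\<in>ball y \<delta>. ennreal \<kappa> * emeasure \<nu> (ball x \<rho>) < emeasure \<nu> (ball x \<rho> \<inter> H))"
    if "y \<in> K" for y
    using max_set_locally_uniform[OF sets H, of y \<kappa>] K(2) that by (metis subsetD)
  then obtain \<delta> \<rho> where \<delta>: "\<And>y. y \<in> K \<Longrightarrow> 0 < \<delta> y" and \<rho>: "\<And>y. y \<in> K \<Longrightarrow> 0 < \<rho> y"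
    and unif: "\<And>y x. y \<in> K \<Longrightarrow> x \<in> ball y (\<delta> y) \<Longrightarrow>
      ennreal \<kappa> * emeasure \<nu> (ball x (\<rho> y)) < emeasure \<nu> (ball x (\<rho> y) \<inter> H)"
    by metis
  obtain F where F: "F \<subseteq> K" "finite F" "K \<subseteq> (\<Union>y\<in>F. ball y (\<delta> y))"
  proof (rule compactE_image[OF K(1), of K "\<lambda>y. ball y (\<delta> y)"])
    show "K \<subseteq> (\<Union>y\<in>K. ball y (\<delta> y))" using \<delta> by force
  qed auto
  \<comment> \<open>Each point of \<open>K\<close> borrows the radius of one of the finitely many
    centres in \<open>F\<close>, since the selection works with a finite set of radii.\<close>
  define c where "c x = (SOME y. y \<in> F \<and> x \<in> ball y (\<delta> y))" for x
  have c: "c x \<in> F" "x \<in> ball (c x) (\<delta> (c x))" if "x \<in> K" for x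
  proof -
    have "\<exists>y. y \<in> F \<and> x \<in> ball y (\<delta> y)" using F(3) that by blast
    from someI_ex[OF this] show "c x \<in> F" "x \<in> ball (c x) (\<delta> (c x))"
      unfolding c_def by auto
  qed
  define r where "r x = \<rho> (c x)" for x
  obtain S where S: "finite S" "S \<subseteq> K" "K \<subseteq> (\<Union>x\<in>S. ball x (r x))"
      "\<forall>x\<in>S. \<forall>y\<in>S. x \<noteq> y \<longrightarrow> max (r x) (r y) \<le> dist x y"
    using besicovitch_selection[of K "\<rho> ` F" r] K(1) F c \<rho>
    by (force simp: r_def compact_imp_bounded)
  have "ennreal \<kappa> * emeasure \<nu> K \<le> ennreal \<kappa> * emeasure \<nu> (\<Union>x\<in>S. ball x (r x))"
    using S(1,3) by (intro mult_left_mono emeasure_mono) (auto simp: sets)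
  also have "\<dots> \<le> ennreal \<kappa> * (\<Sum>x\<in>S. emeasure \<nu> (ball x (r x)))"
    using S(1) by (intro mult_left_mono emeasure_subadditive_finite) (auto simp: sets)
  also have "\<dots> = (\<Sum>x\<in>S. ennreal \<kappa> * emeasure \<nu> (ball x (r x)))"
    by (simp add: sum_distrib_left)
  also have "\<dots> \<le> (\<Sum>x\<in>S. emeasure \<nu> (ball x (r x) \<inter> H))"
  proof (rule sum_mono)
    fix x assume "x \<in> S"
    then have "x \<in> K" using S(2) by blast
    from unif[of "c x" x] c[OF this] F(1) 
    show "ennreal \<kappa> * emeasure \<nu> (ball x (r x)) \<le> emeasure \<nu> (ball x (r x) \<inter> H)"
      unfolding r_def by (meson less_imp_le subsetD)
  qed
  also have "\<dots> = (\<Sum>x\<in>S. \<integral>\<^sup>+z. indicator (ball x (r x) \<inter> H) z \<partial>\<nu>)"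
    by (intro sum.cong refl nn_integral_indicator[symmetric]) (auto simp: sets)
  also have "\<dots> = (\<integral>\<^sup>+z. (\<Sum>x\<in>S. indicator (ball x (r x) \<inter> H) z) \<partial>\<nu>)"
    by (intro nn_integral_sum[symmetric] borel_measurable_indicator) (auto simp: sets)
  also have "\<dots> \<le> (\<integral>\<^sup>+z. of_nat C * indicator H z \<partial>\<nu>)"
  proof (rule nn_integral_mono)
    fix z
    have "(\<Sum>x\<in>S. indicator (ball x (r x) \<inter> H) z) =
        (\<Sum>x\<in>S. if z \<in> ball x (r x) then indicator H z else (0::ennreal))"
      by (intro sum.cong refl) (auto simp: indicator_def)
    also have "\<dots> = of_nat (card {x \<in> S. z \<in> ball x (r x)}) * indicator H z"
      using S(1) by (simp add: sum.If_cases Int_def)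
    also have "\<dots> \<le> of_nat C * indicator H z"
      using C[rule_format, of S r z] S(4) by (intro mult_right_mono) auto
    finally show "(\<Sum>x\<in>S. indicator (ball x (r x) \<inter> H) z) \<le> of_nat C * (indicator H z :: ennreal)" .
  qed
  also have "\<dots> = of_nat C * emeasure \<nu> H"
    by (subst nn_integral_cmult) (auto simp: sets)
  finally show ?thesis .
qed

text \<open>\<open>C\<close> is chosen before the measure and depends on the space only. Inner
  regularity carries the bound from compact subsets to the open set \<open>max_set\<close>.\<close>

lemma max_set_bound:
  obtains C :: nat where "\<And>(\<nu> :: 'a::euclidean_space measure) H \<kappa>. sets \<nu> = sets borel \<Longrightarrow>
    finite_measure \<nu> \<Longrightarrow> H \<in> sets borel \<Longrightarrow>
    ennreal \<kappa> * emeasure \<nu> (max_set \<nu> \<kappa> H) \<le> of_nat C * emeasure \<nu> H"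
proof -
  obtain C :: nat where C: "\<forall>S (r :: 'a \<Rightarrow> real) z.
       (\<forall>x\<in>S. \<forall>y\<in>S. x \<noteq> y \<longrightarrow> max (r x) (r y) \<le> dist x y) \<longrightarrow>
       card {x \<in> S. z \<in> ball x (r x)} \<le> C"
    using ball_overlap_bound[where 'a = 'a] by (elim exE)
  have "ennreal \<kappa> * emeasure \<nu> (max_set \<nu> \<kappa> H) \<le> of_nat C * emeasure \<nu> H"
    if s: "sets \<nu> = sets borel" and fin: "finite_measure \<nu>" and H: "H \<in> sets borel"
    for \<nu> :: "'a measure" and H \<kappa>
  proof -
    interpret finite_measure \<nu> by fact
    have "emeasure \<nu> (max_set \<nu> \<kappa> H) = (SUP K \<in> {K. K \<subseteq> max_set \<nu> \<kappa> H \<and> compact K}. emeasure \<nu> K)"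
      using open_max_set[OF s H] by (intro inner_regular) (auto simp: s)
    then have "ennreal \<kappa> * emeasure \<nu> (max_set \<nu> \<kappa> H) =
        (SUP K \<in> {K. K \<subseteq> max_set \<nu> \<kappa> H \<and> compact K}. ennreal \<kappa> * emeasure \<nu> K)"
      by (simp add: SUP_mult_left_ennreal)
    also have "\<dots> \<le> of_nat C * emeasure \<nu> H"
      using compact_max_set_bound[OF s H _ _ C] by (intro SUP_least) auto
    finally show ?thesis .
  qed
  then show thesis by (rule that)
qed

lemma compact_approx:
  fixes M :: "'a::polish_space measure"
  assumes s: "sets M = sets borel" and "finite_measure M" and E: "E \<in> sets borel" and "0 < e"
  shows "\<exists>K. compact K \<and> K \<subseteq> E \<and> emeasure M (E - K) < ennreal e"
proof -
  interpret finite_measure M by fact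
  have "emeasure M E = (SUP K \<in> {K. K \<subseteq> E \<and> compact K}. emeasure M K)"
    using E by (intro inner_regular) (auto simp: s)
  moreover have "emeasure M E \<noteq> \<infinity>" by simp
  ultimately have "\<exists>K\<in>{K. K \<subseteq> E \<and> compact K}. emeasure M E < emeasure M K + ennreal e"
    using \<open>0 < e\<close> by (intro SUP_approx_ennreal) auto
  then obtain K where K: "K \<subseteq> E" "compact K" "emeasure M E < emeasure M K + ennreal e"
    by blast
  have "emeasure M (E - K) = emeasure M E - emeasure M K"
    using K E by (intro emeasure_Diff) (auto simp: s borel_compact)
  also have "\<dots> < ennreal e"
    using K E by (subst minus_less_iff_ennreal)
      (auto simp: emeasure_mono s less_top[symmetric] add.commute)
  finally show ?thesis using K by blast
qed

text \<open>The complement of \<open>E\<close> is exhausted up to small measure by compact sets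
  \<open>K m\<close>. A point of \<open>E\<close> has a ball missing \<open>K m\<close>, so small
  balls around it see the complement only through \<open>- E - K m\<close>. A point violating the
  density condition thus lies in the maximal set of each of these small sets, and the weak-type
  inequality makes the intersection null.\<close>

lemma AE_density_point:
  fixes \<nu> :: "'a::euclidean_space measure"
  assumes s: "sets \<nu> = sets borel" and fin: "finite_measure \<nu>" and E: "E \<in> sets borel"
  shows "AE y in \<nu>. y \<in> E \<longrightarrow> (\<forall>\<kappa>>0. eventually (\<lambda>\<epsilon>.
    emeasure \<nu> (ball y \<epsilon> - E) \<le> ennreal \<kappa> * emeasure \<nu> (ball y \<epsilon>)) (at_right 0))"
proof -
  interpret finite_measure \<nu> by fact
  obtain C :: nat where C: "\<And>H \<kappa>. H \<in> sets borel \<Longrightarrow>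
      ennreal \<kappa> * emeasure \<nu> (max_set \<nu> \<kappa> H) \<le> of_nat C * emeasure \<nu> H"
    using max_set_bound s fin by metis
  let ?good = "\<lambda>\<kappa> y. eventually (\<lambda>\<epsilon>.
    emeasure \<nu> (ball y \<epsilon> - E) \<le> ennreal \<kappa> * emeasure \<nu> (ball y \<epsilon>)) (at_right 0)"
  have "AE y in \<nu>. y \<in> E \<longrightarrow> ?good (1 / real (Suc n)) y" for n
  proof -
    let ?\<kappa> = "1 / real (Suc n)"
    have "\<exists>K. compact K \<and> K \<subseteq> - E \<and> emeasure \<nu> (- E - K) < ennreal (1 / real (Suc m))" for m
      using compact_approx[OF s fin, of "- E" "1 / real (Suc m)"] E by auto
    then obtain K where K: "\<And>m. compact (K m)" "\<And>m. K m \<subseteq> - E"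
        "\<And>m. emeasure \<nu> (- E - K m) < ennreal (1 / real (Suc m))"
      by metis
    have Hm: "- E - K m \<in> sets borel" for m using E K(1)[of m] by (auto simp: borel_compact)
    define N where "N = (\<Inter>m. max_set \<nu> ?\<kappa> (- E - K m))"
    have N: "N \<in> sets \<nu>"
      unfolding N_def using open_max_set[OF s Hm] by (auto simp: s)
    have le: "ennreal ?\<kappa> * emeasure \<nu> N \<le> of_nat C * ennreal (1 / real (Suc m))" for m
    proof -
      have "ennreal ?\<kappa> * emeasure \<nu> N \<le> ennreal ?\<kappa> * emeasure \<nu> (max_set \<nu> ?\<kappa> (- E - K m))"
        using open_max_set[OF s Hm] by (intro mult_left_mono emeasure_mono) (auto simp: N_def s)
      also have "\<dots> \<le> of_nat C * emeasure \<nu> (- E - K m)" by (rule C[OF Hm])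
      also have "\<dots> \<le> of_nat C * ennreal (1 / real (Suc m))"
        using K(3)[of m] by (intro mult_left_mono) auto
      finally show ?thesis .
    qed
    have "ennreal ?\<kappa> * emeasure \<nu> N \<le> 0"
    proof (rule LIMSEQ_le_const)
      have "(\<lambda>m. ennreal (real C * (1 / real (Suc m)))) \<longlonglongrightarrow> ennreal (real C * 0)"
        by (intro tendsto_ennrealI tendsto_mult tendsto_const LIMSEQ_Suc[OF lim_1_over_n])
      then show "(\<lambda>m. of_nat C * ennreal (1 / real (Suc m))) \<longlonglongrightarrow> 0"
        by (simp add: ennreal_mult' ennreal_of_nat_eq_real_of_nat del: times_divide_eq_right mult_1_right)
      show "\<exists>N'. \<forall>m\<ge>N'. ennreal ?\<kappa> * emeasure \<nu> N \<le> of_nat C * ennreal (1 / real (Suc m))"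
        using le by blast
    qed
    then have "emeasure \<nu> N = 0" by (simp del: of_nat_Suc)
    then have "N \<in> null_sets \<nu>" using N by auto
    moreover have "y \<in> N" if y: "y \<in> E" "\<not> ?good ?\<kappa> y" for y
      unfolding N_def
    proof
      fix m
      have "closed (K m)" "y \<notin> K m" using K(1,2) y(1) compact_imp_closed by blast+
      then obtain d where d: "0 < d" "ball y d \<subseteq> - K m"
        by (meson ComplI open_Compl open_contains_ball)
      from y(2) have "\<exists>\<epsilon>. 0 < \<epsilon> \<and> \<epsilon> < d \<and>
          \<not> emeasure \<nu> (ball y \<epsilon> - E) \<le> ennreal ?\<kappa> * emeasure \<nu> (ball y \<epsilon>)"
        unfolding eventually_at_right_field using d(1) by (metis)
      then obtain \<epsilon> where \<epsilon>: "0 < \<epsilon>" "\<epsilon> < d"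
          "ennreal ?\<kappa> * emeasure \<nu> (ball y \<epsilon>) < emeasure \<nu> (ball y \<epsilon> - E)"
        by (auto simp: not_le)
      have "ball y \<epsilon> - E = ball y \<epsilon> \<inter> (- E - K m)"
        using d(2) subset_ball[of \<epsilon> d y] \<epsilon>(2) by auto
      with \<epsilon> show "y \<in> max_set \<nu> ?\<kappa> (- E - K m)"
        unfolding max_set_def by auto
    qed
    ultimately show ?thesis
      by (intro AE_I'[of N]) auto
  qed
  then have "AE y in \<nu>. \<forall>n. y \<in> E \<longrightarrow> ?good (1 / real (Suc n)) y"
    by (subst AE_all_countable) blast
  then show ?thesis
  proof (rule AE_mp, intro AE_I2 impI allI)
    fix y and \<kappa> :: real
    assume y: "\<forall>n. y \<in> E \<longrightarrow> ?good (1 / real (Suc n)) y" "y \<in> E" "0 < \<kappa>"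
    then obtain n where n: "1 / real (Suc n) < \<kappa>" using nat_approx_posE by blast
    have "?good (1 / real (Suc n)) y" using y by blast
    then show "?good \<kappa> y"
    proof eventually_elim
      case (elim \<epsilon>)
      also have "ennreal (1 / real (Suc n)) * emeasure \<nu> (ball y \<epsilon>) \<le> ennreal \<kappa> * emeasure \<nu> (ball y \<epsilon>)"
        using n by (intro mult_right_mono ennreal_leI) auto
      finally show ?case .
    qed
  qed
qed

section \<open>Almost sure predictability\<close>

text \<open>Off the support every point has a null ball, and by Lindelof countably many null balls
  cover these points.\<close>

lemma AE_in_measure_supp:
  fixes \<nu> :: "'b::{metric_space, second_countable_topology} measure"
  assumes s: "sets \<nu> = sets borel"
  shows "AE y in \<nu>. y \<in> measure_supp \<nu>"
proof -
  let ?F = "{ball y \<epsilon> | y \<epsilon>. emeasure \<nu> (ball y \<epsilon>) = 0}"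
  obtain F where F: "F \<subseteq> ?F" "countable F" "\<Union>F = \<Union>?F"
    using Lindelof[of ?F] by auto
  have "\<Union>F \<in> null_sets \<nu>"
  proof -
    have "U \<in> null_sets \<nu>" if "U \<in> F" for U
      using that F(1) by (force simp: null_sets_def s)
    from null_sets_UN'[of F "\<lambda>U. U", OF F(2) this] show ?thesis by simp
  qed
  moreover have "y \<in> \<Union>F" if "y \<notin> measure_supp \<nu>" for y
  proof -
    obtain \<epsilon> where "0 < \<epsilon>" "emeasure \<nu> (ball y \<epsilon>) = 0"
      using \<open>y \<notin> measure_supp \<nu>\<close> by (auto simp: measure_supp_def)
    moreover from this have "y \<in> ball y \<epsilon>" by simp
    ultimately show ?thesis unfolding F(3) by blast
  qed
  ultimately show ?thesis by (intro AE_I'[of "\<Union>F"]) auto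
qed

text \<open>Meant for small \<open>\<delta>\<close> and \<open>\<kappa>\<close>: on
  \<open>B\<close>, up to a part of relative measure \<open>\<kappa>\<close>, \<open>f\<close> is
  close to a constant \<open>d\<close>. The mean \<open>m\<close> is then within
  \<open>\<delta> + R * \<kappa>\<close> of \<open>d\<close>, so deviations can be estimated from
  \<open>d\<close> first and moved to \<open>m\<close> afterwards.\<close>

lemma (in finite_measure) mean_square_deviation_le:
  fixes f :: "'a \<Rightarrow> 'b::euclidean_space"
  assumes f[measurable]: "f \<in> borel_measurable M"
    and B[measurable]: "B \<in> sets M" and pos: "0 < measure M B"
    and Bad[measurable]: "Bad \<in> sets M" and small: "measure M Bad \<le> \<kappa> * measure M B"
    and bound: "AE x in M. x \<in> B \<longrightarrow> norm (f x - d) \<le> \<delta> + (if x \<in> Bad then R else 0)"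
    and R: "0 \<le> R" and \<delta>: "0 \<le> \<delta>"
  defines "m \<equiv> (1 / measure M B) *\<^sub>R (LINT x:B|M. f x)"
  shows "(1 / measure M B) * (LINT x:B|M. (norm (f x - m))\<^sup>2) \<le>
    2 * (\<delta> + R * \<kappa>)\<^sup>2 + 2 * \<delta>\<^sup>2 + (4 * \<delta> * R + 2 * R\<^sup>2) * \<kappa>"
proof -
  have int: "set_integrable M B h"
    if "h \<in> borel_measurable M" "AE x in M. x \<in> B \<longrightarrow> norm (h x) \<le> C" "0 \<le> C"
    for h :: "'a \<Rightarrow> 'c::{banach, second_countable_topology}" and C
    unfolding set_integrable_def
    using that by (intro integrable_const_bound[of _ C]) (auto elim!: eventually_mono split: split_indicator)
  have int_const: "set_integrable M B (\<lambda>_. c)" for c :: "'c::{banach, second_countable_topology}"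
    by (rule int[of _ "norm c"]) auto
  have int_ind: "set_integrable M B (\<lambda>x. c * indicator Bad x)" for c :: real
    by (rule int[of _ "\<bar>c\<bar>"]) (auto split: split_indicator)
  have LINT_le: "(LINT x:B|M. h x) \<le> a * measure M B + c * (\<kappa> * measure M B)"
    if h: "set_integrable M B h" and le: "AE x in M. x \<in> B \<longrightarrow> h x \<le> a + c * indicator Bad x"
      and c: "0 \<le> c"
    for h :: "'a \<Rightarrow> real" and a c
  proof -
    have "(LINT x:B|M. h x) \<le> (LINT x:B|M. a + c * indicator Bad x)"
      unfolding set_lebesgue_integral_def
    proof (rule integral_mono_AE)
      show "integrable M (\<lambda>x. indicator B x *\<^sub>R h x)" using h by (simp add: set_integrable_def)
      show "integrable M (\<lambda>x. indicator B x *\<^sub>R (a + c * indicator Bad x))"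
        using set_integral_add(1)[OF int_const int_ind] by (simp add: set_integrable_def)
      show "AE x in M. indicator B x *\<^sub>R h x \<le> indicator B x *\<^sub>R (a + c * indicator Bad x)"
        using le by eventually_elim (auto split: split_indicator)
    qed
    also have "\<dots> = a * measure M B + c * measure M (B \<inter> Bad)"
    proof -
      have "(LINT x:B|M. a) = a * measure M B"
        unfolding set_lebesgue_integral_def by (simp add: mult.commute)
      moreover have "(LINT x:B|M. c * indicator Bad x) = c * measure M (B \<inter> Bad)"
        unfolding set_lebesgue_integral_def
        by (simp add: mult.left_commute flip: indicator_inter_arith)
      ultimately show ?thesis by (simp add: set_integral_add(2)[OF int_const int_ind])
    qed
    also have "measure M (B \<inter> Bad) \<le> measure M Bad"
      by (intro finite_measure_mono) auto
    then have "a * measure M B + c * measure M (B \<inter> Bad) \<le> a * measure M B + c * (\<kappa> * measure M B)"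
      using c small by (intro add_left_mono mult_left_mono) auto
    finally show ?thesis .
  qed
  have fd: "AE x in M. x \<in> B \<longrightarrow> norm (f x - d) \<le> \<delta> + R"
    using bound
  proof eventually_elim
    case (elim x)
    then show ?case using R by (cases "x \<in> Bad") auto
  qed
  have int_fd: "set_integrable M B (\<lambda>x. f x - d)"
    using fd R \<delta> by (intro int[of _ "\<delta> + R"]) auto
  have "set_integrable M B f" using set_integral_add(1)[OF int_fd int_const[of d]] by simp
  moreover have "(LINT x:B|M. d) = measure M B *\<^sub>R d"
    unfolding set_lebesgue_integral_def
    by (subst integral_scaleR_left) (auto simp: emeasure_eq_measure)
  ultimately have "(LINT x:B|M. f x - d) = (LINT x:B|M. f x) - measure M B *\<^sub>R d"
    using set_integral_diff(2)[OF _ int_const[of d]] by simp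
  then have m: "m - d = (1 / measure M B) *\<^sub>R (LINT x:B|M. f x - d)"
    using pos by (simp add: m_def scaleR_diff_right)
  have "norm (LINT x:B|M. f x - d) \<le> (LINT x:B|M. norm (f x - d))"
    using int_fd set_integral_norm_bound by blast
  also have "\<dots> \<le> \<delta> * measure M B + R * (\<kappa> * measure M B)"
  proof (rule LINT_le)
    show "set_integrable M B (\<lambda>x. norm (f x - d))" using int_fd by (rule set_integrable_norm)
    show "AE x in M. x \<in> B \<longrightarrow> norm (f x - d) \<le> \<delta> + R * indicator Bad x"
      using bound by eventually_elim (auto split: split_indicator if_splits)
  qed (rule R)
  also have "\<dots> = (\<delta> + R * \<kappa>) * measure M B" by (simp add: algebra_simps)
  finally have md: "norm (m - d) \<le> \<delta> + R * \<kappa>"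
    unfolding m using pos by (simp add: pos_divide_le_eq)
  have sq: "(norm (f x - m))\<^sup>2 \<le> 2 * (norm (f x - d))\<^sup>2 + 2 * (\<delta> + R * \<kappa>)\<^sup>2" for x
  proof -
    have "norm (f x - m) \<le> norm (f x - d) + norm (m - d)"
      using norm_triangle_ineq4[of "f x - d" "m - d"] by simp
    also have "\<dots> \<le> norm (f x - d) + (\<delta> + R * \<kappa>)" using md by simp
    finally have "(norm (f x - m))\<^sup>2 \<le> (norm (f x - d) + (\<delta> + R * \<kappa>))\<^sup>2"
      by (intro power_mono) auto
    also have "\<dots> \<le> 2 * (norm (f x - d))\<^sup>2 + 2 * (\<delta> + R * \<kappa>)\<^sup>2"
      using sum_squares_bound[of "norm (f x - d)" "\<delta> + R * \<kappa>"]
        power2_sum[of "norm (f x - d)" "\<delta> + R * \<kappa>"] by linarith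
    finally show ?thesis .
  qed
  \<comment> \<open>The squared distance to \<open>d\<close> is at most
    \<open>\<delta>\<^sup>2\<close> off \<open>Bad\<close> and \<open>(\<delta> + R)\<^sup>2\<close>
    on it; twice the excess is \<open>4 * \<delta> * R + 2 * R\<^sup>2\<close>. The remaining term
    comes from \<open>sq\<close>.\<close>
  have "(LINT x:B|M. (norm (f x - m))\<^sup>2) \<le>
      (2 * \<delta>\<^sup>2 + 2 * (\<delta> + R * \<kappa>)\<^sup>2) * measure M B + (4 * \<delta> * R + 2 * R\<^sup>2) * (\<kappa> * measure M B)"
  proof (rule LINT_le)
    have fm: "AE x in M. x \<in> B \<longrightarrow> (norm (f x - m))\<^sup>2 \<le> 2 * (\<delta> + R)\<^sup>2 + 2 * (\<delta> + R * \<kappa>)\<^sup>2"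
      using fd
    proof eventually_elim
      case (elim x)
      show ?case
      proof
        assume "x \<in> B"
        with elim have "(norm (f x - d))\<^sup>2 \<le> (\<delta> + R)\<^sup>2" by (intro power_mono) auto
        with sq[of x] show "(norm (f x - m))\<^sup>2 \<le> 2 * (\<delta> + R)\<^sup>2 + 2 * (\<delta> + R * \<kappa>)\<^sup>2" by linarith
      qed
    qed
    then show "set_integrable M B (\<lambda>x. (norm (f x - m))\<^sup>2)"
      by (intro int[of _ "2 * (\<delta> + R)\<^sup>2 + 2 * (\<delta> + R * \<kappa>)\<^sup>2"]) auto
    show "AE x in M. x \<in> B \<longrightarrow> (norm (f x - m))\<^sup>2 \<le>
        2 * \<delta>\<^sup>2 + 2 * (\<delta> + R * \<kappa>)\<^sup>2 + (4 * \<delta> * R + 2 * R\<^sup>2) * indicator Bad x"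
      using bound
    proof eventually_elim
      case (elim x)
      show ?case
      proof
        assume "x \<in> B"
        with elim have "(norm (f x - d))\<^sup>2 \<le> (\<delta> + (if x \<in> Bad then R else 0))\<^sup>2"
          by (intro power_mono) auto
        then have "2 * (norm (f x - d))\<^sup>2 \<le> 2 * \<delta>\<^sup>2 + (4 * \<delta> * R + 2 * R\<^sup>2) * indicator Bad x"
          by (auto simp: power2_sum algebra_simps split: split_indicator if_splits)
        with sq[of x] show "(norm (f x - m))\<^sup>2 \<le>
            2 * \<delta>\<^sup>2 + 2 * (\<delta> + R * \<kappa>)\<^sup>2 + (4 * \<delta> * R + 2 * R\<^sup>2) * indicator Bad x"
          by linarith
      qed
    qed
  qed (use R \<delta> in auto)
  also have "\<dots> = (2 * (\<delta> + R * \<kappa>)\<^sup>2 + 2 * \<delta>\<^sup>2 + (4 * \<delta> * R + 2 * R\<^sup>2) * \<kappa>) * measure M B"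
    by (simp add: algebra_simps)
  finally show ?thesis using pos by (simp add: pos_divide_le_eq)
qed

text \<open>Injectivity lets sets in the delay space speak about points: if \<open>\<phi> x\<close>
  lies in \<open>E d m\<close>, then \<open>x\<close> itself, and not just some point with the same
  delay vector, has \<open>\<phi> (T x)\<close> near \<open>d\<close>. Since the domain is a
  countable union of compact sets, so are the sets \<open>E d m\<close>, which makes them
  Borel.\<close>

lemma AE_predictable:
  fixes \<mu> :: "'a::metric_space measure" and \<phi> :: "'a \<Rightarrow> 'b::euclidean_space"
  assumes X: "compact X" and \<mu>: "finite_measure \<mu>" "sets \<mu> = sets (restrict_space borel X)"
    and \<phi>: "continuous_on X \<phi>" and T: "T \<in> X \<rightarrow> X" "continuous_on X T"
    and K: "\<And>n :: nat. compact (K n)" "\<And>n. K n \<subseteq> X" "AE x in \<mu>. x \<in> (\<Union>n. K n)"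
    and inj: "inj_on \<phi> (\<Union>n. K n)"
  shows "AE y in distr \<mu> borel \<phi>. predictable \<mu> T \<phi> y"
proof -
  interpret finite_measure \<mu> by fact
  define \<nu> where "\<nu> = distr \<mu> borel \<phi>"
  define A where "A = (\<Union>n. K n)"
  have space: "space \<mu> = X"
    using sets_eq_imp_space_eq[OF \<mu>(2)] by (simp add: space_restrict_space)
  have meas: "f \<in> borel_measurable \<mu>" if "continuous_on X f" for f :: "'a \<Rightarrow> 'b"
    using borel_measurable_continuous_on_restrict[OF that] measurable_cong_sets[OF \<mu>(2) refl] by blast
  have \<phi>m[measurable]: "\<phi> \<in> borel_measurable \<mu>" by (rule meas[OF \<phi>])
  define f where "f x = \<phi> (T x)" for x
  have f: "continuous_on X f"
    unfolding f_def using T by (intro continuous_on_compose2[OF \<phi>]) auto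
  note fm[measurable] = meas[OF f]
  have s\<nu>: "sets \<nu> = sets borel" by (simp add: \<nu>_def)
  have fin\<nu>: "finite_measure \<nu>" unfolding \<nu>_def by (rule finite_measure_distr) measurable
  obtain R where R: "\<And>x. x \<in> X \<Longrightarrow> norm (f x) \<le> R" "0 \<le> R"
  proof -
    from compact_imp_bounded[OF compact_continuous_image[OF f X]]
    obtain R where "\<forall>y\<in>f ` X. norm y \<le> R" by (auto simp: bounded_iff)
    then show thesis by (intro that[of "max R 0"]) auto
  qed
  obtain D :: "'b set" where D: "countable D" "\<And>U. open U \<Longrightarrow> U \<noteq> {} \<Longrightarrow> \<exists>d\<in>D. d \<in> U"
    using countable_dense_setE by blast
  define E where "E d m = \<phi> ` {x \<in> A. dist d (f x) \<le> 1 / real (Suc m)}" for d m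
  have compact_im: "compact (\<phi> ` (K n \<inter> f -` C))" if "closed C" for n C
  proof (rule compact_continuous_image)
    show "continuous_on (K n \<inter> f -` C) \<phi>" by (rule continuous_on_subset[OF \<phi>]) (use K(2) in auto)
    have "closed (K n \<inter> f -` C)"
      by (rule continuous_closed_preimage[OF continuous_on_subset[OF f K(2)] compact_imp_closed[OF K(1)] that])
    then show "compact (K n \<inter> f -` C)"
      using K(1) by (metis compact_Int_closed inf.left_idem)
  qed
  have Eb: "E d m \<in> sets borel" for d m
  proof -
    have "E d m = (\<Union>n. \<phi> ` (K n \<inter> f -` cball d (1 / real (Suc m))))"
      unfolding E_def A_def image_UN[symmetric] by (intro arg_cong[of _ _ "image \<phi>"]) auto
    also have "\<dots> \<in> sets borel"
      using compact_im[of "cball d (1 / real (Suc m))"] by (intro sets.countable_UN) (auto simp: borel_compact)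
    finally show ?thesis .
  qed
  have Ab: "\<phi> ` A \<in> sets borel"
  proof -
    have "\<phi> ` A = (\<Union>n. \<phi> ` (K n \<inter> f -` UNIV))" unfolding A_def by auto
    also have "\<dots> \<in> sets borel"
      using compact_im[of UNIV] by (intro sets.countable_UN) (auto simp: borel_compact)
    finally show ?thesis .
  qed
  have "AE y in \<nu>. \<forall>d\<in>D. \<forall>m. y \<in> E d m \<longrightarrow> (\<forall>\<kappa>>0. eventually (\<lambda>\<epsilon>.
      emeasure \<nu> (ball y \<epsilon> - E d m) \<le> ennreal \<kappa> * emeasure \<nu> (ball y \<epsilon>)) (at_right 0))"
    using AE_density_point[OF s\<nu> fin\<nu> Eb] D(1) by (simp only: AE_ball_countable AE_all_countable) blast
  moreover have "AE y in \<nu>. y \<in> \<phi> ` A"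
    unfolding \<nu>_def using K(3) Ab
    by (subst AE_distr_iff) (auto simp: A_def elim: eventually_mono)
  moreover note AE_in_measure_supp[OF s\<nu>]
  ultimately have "AE y in \<nu>. predictable \<mu> T \<phi> y"
  proof eventually_elim
    case (elim y)
    then obtain x0 where x0: "x0 \<in> A" "y = \<phi> x0" by blast
    have "x0 \<in> X" using x0 K(2) by (auto simp: A_def)
    \<comment> \<open>\<open>M\<close> bounds \<open>norm (f x - d)\<close>: the values of
      \<open>f\<close> have norm at most \<open>R\<close>, and \<open>d\<close>, chosen within 1 of
      \<open>f x0\<close>, has norm at most \<open>R + 1\<close>. \<open>b m\<close> is the
      resulting error bound when closeness and relative measure are both 1/(m+1).\<close>
    define M where "M = 2 * R + 1"
    define b where "b m = sqrt (2 * (1 / real (Suc m) + M * (1 / real (Suc m)))\<^sup>2 + 2 * (1 / real (Suc m))\<^sup>2 +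
      (4 * (1 / real (Suc m)) * M + 2 * M\<^sup>2) * (1 / real (Suc m)))" for m
    have M: "0 \<le> M" using R(2) by (simp add: M_def)
    have ev: "eventually (\<lambda>\<epsilon>. prediction_error \<mu> T \<phi> \<epsilon> y \<le> b m) (at_right 0)" for m
    proof -
      define \<delta> where "\<delta> = 1 / real (Suc m)"
      have \<delta>: "0 < \<delta>" "\<delta> \<le> 1" by (simp_all add: \<delta>_def)
      have "\<exists>d\<in>D. d \<in> ball (f x0) \<delta>" using \<delta>(1) by (intro D(2)) auto
      then obtain d where d: "d \<in> D" "dist d (f x0) < \<delta>" by (auto simp: dist_commute)
      have nd: "norm d \<le> R + 1"
        using d(2) R(1)[OF \<open>x0 \<in> X\<close>] \<delta>(2) norm_triangle_ineq2[of d "f x0"]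
        unfolding dist_norm by linarith
      have "y \<in> E d m" unfolding E_def using x0 d(2) by (auto simp: \<delta>_def)
      then have "eventually (\<lambda>\<epsilon>.
          emeasure \<nu> (ball y \<epsilon> - E d m) \<le> ennreal \<delta> * emeasure \<nu> (ball y \<epsilon>)) (at_right 0)"
        using elim(1) d(1) \<delta>(1) by blast
      moreover have "eventually (\<lambda>\<epsilon>::real. 0 < \<epsilon>) (at_right 0)" by (rule eventually_at_right_less)
      ultimately show ?thesis
      proof eventually_elim
        case small: (elim \<epsilon>)
        define B where "B = \<phi> -` ball y \<epsilon> \<inter> space \<mu>"
        define Bad where "Bad = \<phi> -` (ball y \<epsilon> - E d m) \<inter> space \<mu>"
        have B: "B \<in> sets \<mu>" unfolding B_def by measurable
        have Bad: "Bad \<in> sets \<mu>" unfolding Bad_def using Eb by measurable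
        have eB: "emeasure \<nu> (ball y \<epsilon>) = ennreal (measure \<mu> B)"
          unfolding \<nu>_def B_def by (subst emeasure_distr) (auto simp: emeasure_eq_measure)
        have eBad: "emeasure \<nu> (ball y \<epsilon> - E d m) = ennreal (measure \<mu> Bad)"
          unfolding \<nu>_def Bad_def using Eb by (subst emeasure_distr) (auto simp: emeasure_eq_measure)
        have "0 < emeasure \<nu> (ball y \<epsilon>)" using elim(3) small(2) by (auto simp: measure_supp_def)
        then have pos: "0 < measure \<mu> B" by (simp add: eB)
        have le: "measure \<mu> Bad \<le> \<delta> * measure \<mu> B"
          using small(1) \<delta>(1) unfolding eB eBad by (simp flip: ennreal_mult'')
        have bound: "AE x in \<mu>. x \<in> B \<longrightarrow> norm (f x - d) \<le> \<delta> + (if x \<in> Bad then M else 0)"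
          using K(3)
        proof eventually_elim
          case xA: (elim x)
          show ?case
          proof
            assume xB: "x \<in> B"
            show "norm (f x - d) \<le> \<delta> + (if x \<in> Bad then M else 0)"
            proof (cases "x \<in> Bad")
              case True
              have "x \<in> X" using xB by (simp add: B_def space)
              then have "norm (f x - d) \<le> M"
                using R(1)[of x] nd norm_triangle_ineq4[of "f x" d] by (simp add: M_def)
              then show ?thesis using True \<delta>(1) by simp
            next
              case False
              \<comment> \<open>Outside \<open>Bad\<close> the value \<open>\<phi> x\<close> is
                attained at some \<open>x'\<close> in \<open>A\<close> with \<open>f x'\<close> near
                \<open>d\<close>; injectivity on \<open>A\<close> identifies \<open>x'\<close> with
                \<open>x\<close>.\<close>
              with xB have "\<phi> x \<in> E d m" by (auto simp: B_def Bad_def)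
              then obtain x' where x': "x' \<in> A" "dist d (f x') \<le> \<delta>" "\<phi> x = \<phi> x'"
                unfolding E_def \<delta>_def by blast
              then have "x = x'" using inj xA by (auto simp: A_def dest: inj_onD)
              with x' False show ?thesis by (simp add: dist_norm norm_minus_commute)
            qed
          qed
        qed
        have "(1 / measure \<mu> B) *
            (LINT x:B|\<mu>. (norm (f x - (1 / measure \<mu> B) *\<^sub>R (LINT x:B|\<mu>. f x)))\<^sup>2) \<le>
          2 * (\<delta> + M * \<delta>)\<^sup>2 + 2 * \<delta>\<^sup>2 + (4 * \<delta> * M + 2 * M\<^sup>2) * \<delta>"
          by (rule mean_square_deviation_le[OF fm B pos Bad le bound M]) (use \<delta> in simp)
        then show ?case
          unfolding prediction_error_def prediction_mean_def b_def B_def f_def \<delta>_def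
          by (intro real_sqrt_le_mono)
      qed
    qed
    have nonneg: "0 \<le> prediction_error \<mu> T \<phi> \<epsilon> y" for \<epsilon>
      unfolding prediction_error_def set_lebesgue_integral_def
      by (intro real_sqrt_ge_zero mult_nonneg_nonneg integral_nonneg) auto
    have "b \<longlonglongrightarrow> sqrt (2 * (0 + M * 0)\<^sup>2 + 2 * 0\<^sup>2 + (4 * 0 * M + 2 * M\<^sup>2) * 0)"
      unfolding b_def by (intro tendsto_intros LIMSEQ_Suc[OF lim_1_over_n])
    then have b: "b \<longlonglongrightarrow> 0" by simp
    have "((\<lambda>\<epsilon>. prediction_error \<mu> T \<phi> \<epsilon> y) \<longlongrightarrow> 0) (at_right 0)"
    proof (rule tendstoI)
      fix e :: real assume "0 < e"
      with b obtain m where "b m < e"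
        by (metis order_tendstoD(2) eventually_sequentially order_refl)
      show "eventually (\<lambda>\<epsilon>. dist (prediction_error \<mu> T \<phi> \<epsilon> y) 0 < e) (at_right 0)"
        using ev[of m] by eventually_elim (use nonneg \<open>b m < e\<close> in \<open>auto simp: dist_real_def\<close>)
    qed
    with elim(3) show ?case unfolding predictable_def \<nu>_def by blast
  qed
  then show ?thesis unfolding \<nu>_def .
qed

section \<open>The probe: random series of bump functions\<close>

text \<open>Clipping makes the random series below converge for every coefficient sequence, so that the
  probe is the range of a map defined on the whole sequence space.\<close>

definition clip :: "real \<Rightarrow> real" where
  "clip t = max (-1) (min 1 t)"

lemma abs_clip_le: "\<bar>clip t\<bar> \<le> 1"
  by (auto simp: clip_def)

lemma clip_id: "\<bar>t\<bar> \<le> 1 \<Longrightarrow> clip t = t"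
  by (auto simp: clip_def)

lemma clip_0 [simp]: "clip 0 = 0"
  by (simp add: clip_def)

lemma continuous_on_clip: "continuous_on S f \<Longrightarrow> continuous_on S (\<lambda>x. clip (f x))"
  unfolding clip_def by (intro continuous_intros)

lemma clip_clip [simp]: "clip (clip t) = clip t"
  by (auto simp: clip_def)

text \<open>One weight controls both the size and the Lipschitz constant of each bump, so the random
  series converges in the Lipschitz norm. The peak heights \<open>c j\<close> are merely positive,
  with no uniform lower bound.\<close>

locale bump_family =
  fixes p :: "nat \<Rightarrow> 'a::metric_space \<Rightarrow> real" and c :: "nat \<Rightarrow> real"
  assumes c_pos: "0 < c j"
    and p_bound: "\<bar>p j z\<bar> \<le> (1/2) ^ j"
    and p_lipschitz: "((1/2) ^ j)-lipschitz_on UNIV (p j)"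
    and p_isolates: "finite F \<Longrightarrow> \<exists>j. p j u = c j \<and> (\<forall>z\<in>F - {u}. p j z = 0)"

text \<open>The index \<open>j\<close> codes a centre from a countable dense set and a steepness
  \<open>n\<close>. The tent \<open>b j\<close> equals 1 within 1/n of its centre and 0 beyond 2/n,
  and has Lipschitz constant at most n; dividing the weight by n brings it down to
  \<open>(1/2) ^ j\<close>.\<close>

lemma ex_bump_family:
  "\<exists>(p :: nat \<Rightarrow> 'a::{metric_space, second_countable_topology} \<Rightarrow> real) c. bump_family p c"
proof -
  obtain D :: "'a set" where D: "countable D" "\<And>U. open U \<Longrightarrow> U \<noteq> {} \<Longrightarrow> \<exists>d\<in>D. d \<in> U"
    using countable_dense_setE by blast
  define d where "d j = from_nat_into D (fst (prod_decode j))" for j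
  define n where "n j = real (Suc (snd (prod_decode j)))" for j
  define w where "w j = (1/2) ^ j / n j" for j
  define b where "b j z = max 0 (min 1 (2 - n j * dist (d j) z))" for j z
  have n: "1 \<le> n j" for j by (simp add: n_def)
  have w: "0 < w j" "w j \<le> (1/2) ^ j" "w j * n j = (1/2) ^ j" for j
  proof -
    show "0 < w j" using n[of j] by (simp add: w_def)
    show "w j \<le> (1/2) ^ j" using n[of j] frac_le[of "(1/2)^j" "(1/2)^j" 1 "n j"] by (simp add: w_def)
    show "w j * n j = (1/2) ^ j" using n[of j] by (simp add: w_def)
  qed
  have b01: "0 \<le> b j z" "b j z \<le> 1" for j z by (auto simp: b_def)
  have b_lip: "\<bar>b j x - b j y\<bar> \<le> n j * dist x y" for j x y
  proof -
    have "\<bar>b j x - b j y\<bar> \<le> \<bar>n j * dist (d j) x - n j * dist (d j) y\<bar>"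
      by (auto simp: b_def)
    also have "\<dots> = n j * \<bar>dist (d j) x - dist (d j) y\<bar>"
      using n[of j] by (simp add: abs_mult flip: right_diff_distrib)
    also have "\<bar>dist (d j) x - dist (d j) y\<bar> \<le> dist x y"
      by (metis abs_dist_diff_le dist_commute)
    finally show ?thesis using n[of j] by (simp add: mult_left_mono)
  qed
  have "bump_family (\<lambda>j z. w j * b j z) w"
  proof
    fix j
    show "0 < w j" by (rule w)
    show "\<bar>w j * b j z\<bar> \<le> (1/2) ^ j" for z
      using w(1,2)[of j] b01[of j z] mult_mono[of "w j" "(1/2)^j" "b j z" 1]
      by (simp add: abs_mult)
    show "((1/2) ^ j)-lipschitz_on UNIV (\<lambda>z. w j * b j z)"
    proof (rule lipschitz_onI)
      fix x y
      have "dist (w j * b j x) (w j * b j y) = w j * \<bar>b j x - b j y\<bar>"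
        using w(1)[of j] by (simp add: dist_real_def abs_mult flip: right_diff_distrib)
      also have "\<dots> \<le> w j * (n j * dist x y)"
        using w(1)[of j] b_lip by (intro mult_left_mono) auto
      also have "\<dots> = (1/2) ^ j * dist x y" by (simp add: w(3)[of j, symmetric])
      finally show "dist (w j * b j x) (w j * b j y) \<le> (1/2) ^ j * dist x y" .
    qed simp
  next
    fix F :: "'a set" and u assume F: "finite F"
    obtain r where r: "0 < r" "\<And>z. z \<in> F - {u} \<Longrightarrow> r \<le> dist u z"
      using finite_set_avoid[OF F, of u] by (metis DiffE insertCI)
    \<comment> \<open>With a centre \<open>e\<close> within 1/(m+1) of \<open>u\<close>, the other
      points of \<open>F\<close> are more than r - r/3 away from \<open>e\<close>, hence at least
      2/(m+1), where the tent vanishes.\<close>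
    obtain m where m: "1 / real (Suc m) < r / 3"
      using nat_approx_posE[of "r / 3"] r(1) by auto
    obtain e where e: "e \<in> D" "dist u e < 1 / real (Suc m)"
      using D(2)[of "ball u (1 / real (Suc m))"] by auto
    then obtain i where i: "from_nat_into D i = e"
      using D(1) by (metis from_nat_into_surj)
    define j where "j = prod_encode (i, m)"
    have j: "d j = e" "n j = real (Suc m)" by (simp_all add: j_def d_def n_def i)
    have M: "n j * (1 / real (Suc m)) = 1" by (simp add: j)
    have "n j * dist e u \<le> 1"
      using e(2) M n[of j] by (metis dist_commute less_imp_le mult_left_mono order_trans zero_le_one)
    then have "b j u = 1" by (simp add: b_def j)
    moreover have "b j z = 0" if "z \<in> F - {u}" for z
    proof -
      have "r \<le> dist u e + dist e z" using r(2)[OF that] dist_triangle[of u z e] by linarith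
      then have "2 * (1 / real (Suc m)) \<le> dist e z" using m e(2) by linarith
      then have "n j * (2 * (1 / real (Suc m))) \<le> n j * dist e z" using n[of j] by (intro mult_left_mono) auto
      then have "2 \<le> n j * dist e z" using M by simp
      then show ?thesis by (simp add: b_def j)
    qed
    ultimately show "\<exists>j. w j * b j u = w j \<and> (\<forall>z\<in>F - {u}. w j * b j z = 0)" by auto
  qed
  then show ?thesis by blast
qed

lemma Lip_norm_le:
  assumes "X \<noteq> {}" "\<And>x. x \<in> X \<Longrightarrow> \<bar>h x\<bar> \<le> a" "b-lipschitz_on X h"
  shows "Lip_norm X h \<le> a + b"
  unfolding Lip_norm_def using assms by (intro add_mono cSUP_least Lip_const_le) auto

context bump_family
begin

definition probe :: "'a set \<Rightarrow> (nat \<Rightarrow> real) \<Rightarrow> 'a \<Rightarrow> real" where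
  "probe X \<alpha> x = (if x \<in> X then \<Sum>j. clip (\<alpha> j) * p j x else 0)"

text \<open>A weighted l^1 distance of the clipped coefficients. It is continuous for the product
  topology and bounds both parts of \<open>Lip_norm\<close> for a difference of probes, so it links
  Tychonoff compactness to compactness in the norm.\<close>

definition gap :: "(nat \<Rightarrow> real) \<Rightarrow> (nat \<Rightarrow> real) \<Rightarrow> real" where
  "gap \<alpha> \<beta> = (\<Sum>j. \<bar>clip (\<alpha> j) - clip (\<beta> j)\<bar> * (1/2) ^ j)"

lemma gap_term_le: "\<bar>clip (\<alpha> j) - clip (\<beta> j)\<bar> * (1/2) ^ j \<le> 2 * (1/2) ^ j"
  using abs_clip_le[of "\<alpha> j"] abs_clip_le[of "\<beta> j"] by (intro mult_right_mono) auto

lemma summable_gap: "summable (\<lambda>j. \<bar>clip (\<alpha> j) - clip (\<beta> j)\<bar> * (1/2) ^ j)"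
  by (rule summable_comparison_test'[of "\<lambda>j. 2 * (1/2) ^ j" 0])
    (use gap_term_le in \<open>auto simp: abs_mult\<close>)

lemma gap_le: "gap \<alpha> \<beta> \<le> 4"
proof -
  have "gap \<alpha> \<beta> \<le> (\<Sum>j. 2 * (1/2) ^ j)"
    unfolding gap_def by (intro suminf_le gap_term_le summable_gap) simp
  also have "\<dots> = 4" by (simp add: suminf_mult suminf_geometric)
  finally show ?thesis .
qed

lemma gap_self [simp]: "gap \<alpha> \<alpha> = 0"
  by (simp add: gap_def)

lemma gap_commute: "gap \<alpha> \<beta> = gap \<beta> \<alpha>"
  by (simp add: gap_def abs_minus_commute)

lemma continuous_on_gap: "continuous_on UNIV (\<lambda>\<alpha>. gap \<alpha> \<beta>)"
  unfolding gap_def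
proof (rule uniform_limit_theorem)
  show "uniform_limit UNIV (\<lambda>n \<alpha>. \<Sum>j<n. \<bar>clip (\<alpha> j) - clip (\<beta> j)\<bar> * (1/2) ^ j)
      (\<lambda>\<alpha>. \<Sum>j. \<bar>clip (\<alpha> j) - clip (\<beta> j)\<bar> * (1/2) ^ j) sequentially"
    by (rule Weierstrass_m_test[of _ _ "\<lambda>j. 2 * (1/2) ^ j"])
      (use gap_term_le in \<open>auto simp: abs_mult\<close>)
  show "\<forall>\<^sub>F n in sequentially. continuous_on UNIV
      (\<lambda>\<alpha>. \<Sum>j<n. \<bar>clip (\<alpha> j) - clip (\<beta> j)\<bar> * (1/2) ^ j)"
    by (intro always_eventually allI continuous_intros continuous_on_clip continuous_on_product_coordinates)
qed simp

lemma summable_probe: "summable (\<lambda>j. clip (\<alpha> j) * p j x)"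
proof (rule summable_comparison_test'[of "\<lambda>j. (1/2) ^ j" 0])
  fix j
  show "norm (clip (\<alpha> j) * p j x) \<le> (1/2) ^ j"
    using mult_mono[OF abs_clip_le[of "\<alpha> j"] p_bound[of j x]] by (simp add: abs_mult)
qed simp

text \<open>Used twice: with \<open>q j = p j x\<close> and \<open>D = 1\<close> for the supremum
  part of the norm, and with \<open>q j = p j x - p j y\<close> and \<open>D = dist x y\<close> for
  the Lipschitz part.\<close>

lemma weighted_sum_diff:
  assumes q: "\<And>j. \<bar>q j\<bar> \<le> (1/2) ^ j * D"
    and s: "summable (\<lambda>j. clip (\<alpha> j) * q j)" "summable (\<lambda>j. clip (\<beta> j) * q j)"
  shows "\<bar>(\<Sum>j. clip (\<alpha> j) * q j) - (\<Sum>j. clip (\<beta> j) * q j)\<bar> \<le> gap \<alpha> \<beta> * D"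
proof -
  have le: "\<bar>(clip (\<alpha> j) - clip (\<beta> j)) * q j\<bar> \<le> \<bar>clip (\<alpha> j) - clip (\<beta> j)\<bar> * (1/2) ^ j * D" for j
    using mult_left_mono[OF q[of j], of "\<bar>clip (\<alpha> j) - clip (\<beta> j)\<bar>"] by (simp add: abs_mult mult.assoc)
  have sg: "summable (\<lambda>j. \<bar>clip (\<alpha> j) - clip (\<beta> j)\<bar> * (1/2) ^ j * D)"
    by (intro summable_mult2 summable_gap)
  have sa: "summable (\<lambda>j. \<bar>(clip (\<alpha> j) - clip (\<beta> j)) * q j\<bar>)"
    by (rule summable_comparison_test'[OF sg, of 0]) (use le in auto)
  have "(\<Sum>j. clip (\<alpha> j) * q j) - (\<Sum>j. clip (\<beta> j) * q j) = (\<Sum>j. (clip (\<alpha> j) - clip (\<beta> j)) * q j)"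
    using suminf_diff[OF s] by (simp add: left_diff_distrib)
  also have "\<bar>\<dots>\<bar> \<le> (\<Sum>j. \<bar>(clip (\<alpha> j) - clip (\<beta> j)) * q j\<bar>)"
    by (rule summable_rabs[OF sa])
  also have "\<dots> \<le> (\<Sum>j. \<bar>clip (\<alpha> j) - clip (\<beta> j)\<bar> * (1/2) ^ j * D)"
    by (rule suminf_le[OF le sa sg])
  also have "\<dots> = gap \<alpha> \<beta> * D"
    unfolding gap_def by (rule suminf_mult2[OF summable_gap, symmetric])
  finally show ?thesis .
qed

lemma probe_diff_le: "\<bar>probe X \<alpha> x - probe X \<beta> x\<bar> \<le> gap \<alpha> \<beta>"
proof (cases "x \<in> X")
  case True
  then show ?thesis
    using weighted_sum_diff[of "\<lambda>j. p j x" 1 \<alpha> \<beta>] p_bound summable_probe by (simp add: probe_def)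
next
  case False
  have "0 \<le> gap \<alpha> \<beta>" unfolding gap_def by (intro suminf_nonneg summable_gap) auto
  with False show ?thesis by (simp add: probe_def)
qed

lemma probe_diff_lipschitz: "(gap \<alpha> \<beta>)-lipschitz_on X (\<lambda>x. probe X \<alpha> x - probe X \<beta> x)"
proof (rule lipschitz_onI)
  fix x y assume xy: "x \<in> X" "y \<in> X"
  have s: "summable (\<lambda>j. clip (\<alpha> j) * (p j x - p j y))" for \<alpha>
    using summable_diff[OF summable_probe[of \<alpha> x] summable_probe[of \<alpha> y]] by (simp add: right_diff_distrib)
  have e: "probe X \<alpha> x - probe X \<alpha> y = (\<Sum>j. clip (\<alpha> j) * (p j x - p j y))" for \<alpha>
    using suminf_diff[OF summable_probe[of \<alpha> x] summable_probe[of \<alpha> y]] xy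
    by (simp add: probe_def right_diff_distrib)
  have "\<bar>p j x - p j y\<bar> \<le> (1/2) ^ j * dist x y" for j
    using lipschitz_onD[OF p_lipschitz, of x y j] by (simp add: dist_real_def)
  from weighted_sum_diff[of "\<lambda>j. p j x - p j y", OF this s s, of \<alpha> \<beta>]
  show "dist (probe X \<alpha> x - probe X \<beta> x) (probe X \<alpha> y - probe X \<beta> y) \<le> gap \<alpha> \<beta> * dist x y"
    unfolding dist_real_def e[symmetric] by (simp add: algebra_simps)
next
  show "0 \<le> gap \<alpha> \<beta>" unfolding gap_def by (intro suminf_nonneg summable_gap) auto
qed

lemma probe_zero [simp]: "probe X (\<lambda>_. 0) = (\<lambda>_. 0)"
  by (auto simp: probe_def fun_eq_iff)

lemma probe_lipschitz: "4-lipschitz_on X (probe X \<alpha>)"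
  using probe_diff_lipschitz[of \<alpha> "\<lambda>_. 0" X] gap_le lipschitz_on_le by fastforce

lemma probe_in_Lip_space: "probe X \<alpha> \<in> Lip_space X"
  unfolding Lip_space_def using probe_lipschitz[of X \<alpha>] by (auto simp: probe_def)

lemma Lip_norm_probe_diff: "X \<noteq> {} \<Longrightarrow> Lip_norm X (probe X \<alpha> - probe X \<beta>) \<le> 2 * gap \<alpha> \<beta>"
  using Lip_norm_le[of X "probe X \<alpha> - probe X \<beta>" "gap \<alpha> \<beta>" "gap \<alpha> \<beta>"]
    probe_diff_le probe_diff_lipschitz[of \<alpha> \<beta> X]
  by (auto simp: fun_diff_def)

lemma continuous_map_probe:
  assumes X: "compact X" "X \<noteq> {}"
  shows "continuous_map euclidean (norm_topology (Lip_space X) (Lip_norm X)) (probe X)"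
proof -
  interpret Metric_space "Lip_space X" "norm_dist (Lip_space X) (Lip_norm X)"
    by (rule Metric_space_Lip_space[OF X])
  show ?thesis
    unfolding norm_topology_def continuous_map_to_metric
  proof (intro ballI allI impI)
    fix \<alpha> and \<epsilon> :: real assume "0 < \<epsilon>"
    let ?U = "{\<beta>. gap \<beta> \<alpha> < \<epsilon> / 2}"
    have "open ?U"
      by (intro open_Collect_less continuous_on_gap continuous_on_const)
    moreover have "probe X \<beta> \<in> mball (probe X \<alpha>) \<epsilon>" if "\<beta> \<in> ?U" for \<beta>
      using that Lip_norm_probe_diff[OF X(2), of \<alpha> \<beta>] probe_in_Lip_space
      by (simp add: norm_dist_def gap_commute)
    moreover have "\<alpha> \<in> ?U" using \<open>0 < \<epsilon>\<close> by simp
    ultimately show "\<exists>U. openin euclidean U \<and> \<alpha> \<in> U \<and> (\<forall>\<beta>\<in>U. probe X \<beta> \<in> mball (probe X \<alpha>) \<epsilon>)"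
      by auto
  qed
qed

text \<open>Clipping is idempotent, so every probe already comes from coefficients in [-1,1]; that
  cube is compact by Tychonoff, and the probe map is continuous into the norm topology.\<close>

lemma compactin_range_probe:
  assumes X: "compact X" "X \<noteq> {}"
  shows "compactin (norm_topology (Lip_space X) (Lip_norm X)) (range (probe X))"
proof -
  have "compactin (product_topology (\<lambda>_::nat. euclideanreal) UNIV) (PiE UNIV (\<lambda>_. {-1..1}))"
    by (simp add: compactin_PiE)
  then have "compactin euclidean (PiE UNIV (\<lambda>_::nat. {-1..1::real}))"
    by (simp add: euclidean_product_topology)
  from image_compactin[OF this continuous_map_probe[OF X]]
  have "compactin (norm_topology (Lip_space X) (Lip_norm X)) (probe X ` PiE UNIV (\<lambda>_. {-1..1}))" .
  moreover have "probe X \<alpha> \<in> probe X ` PiE UNIV (\<lambda>_. {-1..1})" for \<alpha>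
  proof
    show "probe X \<alpha> = probe X (\<lambda>j. clip (\<alpha> j))" by (simp add: probe_def fun_eq_iff)
    show "(\<lambda>j. clip (\<alpha> j)) \<in> PiE UNIV (\<lambda>_. {-1..1})"
      using abs_clip_le by (auto simp: abs_le_iff)
  qed
  then have "range (probe X) = probe X ` PiE UNIV (\<lambda>_. {-1..1})" by blast
  ultimately show ?thesis by simp
qed

end

section \<open>Random coefficients and the criterion for prevalence\<close>

definition cube_measure :: "(nat \<Rightarrow> real) measure" where
  "cube_measure = PiM UNIV (\<lambda>_. uniform_measure lborel {-1..1})"

lemma prob_space_unif: "prob_space (uniform_measure lborel {-1..1::real})"
  by (rule prob_space_uniform_measure) auto

lemma prob_space_cube: "prob_space cube_measure"
  unfolding cube_measure_def by (intro prob_space_PiM prob_space_unif)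

lemma sets_cube [measurable_cong]: "sets cube_measure = sets borel"
  unfolding cube_measure_def sets_PiM_equal_borel[symmetric] by (intro sets_PiM_cong) auto

lemma AE_cube: "AE \<alpha> in cube_measure. \<forall>j. \<bar>\<alpha> j\<bar> \<le> 1"
proof -
  have "AE t in uniform_measure lborel {-1..1::real}. \<bar>t\<bar> \<le> 1"
    by (rule AE_uniform_measureI) auto
  then have "AE \<alpha> in cube_measure. \<bar>\<alpha> j\<bar> \<le> 1" for j
    unfolding cube_measure_def by (intro AE_PiM_component prob_space_unif) auto
  then show ?thesis by (simp add: AE_all_countable)
qed

text \<open>Measurability is demanded for every translate, because an almost sure statement about
  \<open>v + probe X \<alpha>\<close> passes to the image measure only for a measurable event. The
  case \<open>v = 0\<close> gives that \<open>B\<close> itself is Borel.\<close>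

lemma (in bump_family) prevalent_borelI:
  assumes X: "compact X" "X \<noteq> {}"
    and B: "\<And>v. v \<in> Lip_space X \<Longrightarrow> {e \<in> Lip_space X. v + e \<in> B} \<in> sets (norm_borel (Lip_space X) (Lip_norm X))"
    and Bs: "B \<subseteq> Lip_space X"
    and ae: "\<And>v. v \<in> Lip_space X \<Longrightarrow> AE \<alpha> in cube_measure. v + probe X \<alpha> \<in> B"
  shows "prevalent_borel (Lip_space X) (Lip_norm X) B"
proof -
  let ?V = "Lip_space X" and ?N = "norm_borel (Lip_space X) (Lip_norm X)"
  interpret M: Metric_space ?V "norm_dist ?V (Lip_norm X)"
    by (rule Metric_space_Lip_space[OF X])
  interpret P: prob_space cube_measure by (rule prob_space_cube)
  have top: "norm_topology ?V (Lip_norm X) = M.mtopology" by (simp add: norm_topology_def)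
  have gen: "{U. openin (norm_topology ?V (Lip_norm X)) U} \<subseteq> Pow ?V"
    unfolding top using openin_subset by fastforce
  have spN: "space ?N = ?V" unfolding norm_borel_def using gen by (rule space_measure_of)
  have setsN: "sets ?N = sigma_sets ?V {U. openin (norm_topology ?V (Lip_norm X)) U}"
    unfolding norm_borel_def using gen by (rule sets_measure_of)
  have meas: "probe X \<in> measurable cube_measure ?N"
    unfolding norm_borel_def
  proof (rule measurable_measure_of[OF gen])
    show "probe X \<in> space cube_measure \<rightarrow> ?V" using probe_in_Lip_space by blast
    fix U assume "U \<in> {U. openin (norm_topology ?V (Lip_norm X)) U}"
    then have "openin euclidean {\<alpha> \<in> topspace euclidean. probe X \<alpha> \<in> U}"
      using continuous_map_probe[OF X] by (auto simp: continuous_map_def)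
    then have "open (probe X -` U)" by (simp add: vimage_def)
    moreover have "space cube_measure = UNIV"
      using sets_eq_imp_space_eq[OF sets_cube] by simp
    ultimately show "probe X -` U \<inter> space cube_measure \<in> sets cube_measure"
      by (simp add: sets_cube)
  qed
  \<comment> \<open>The transverse measure is the law of the random probe. All its mass sits on the
    compact range of the probe map, which is closed, hence Borel, as the topology is
    Hausdorff.\<close>
  define \<Lambda> where "\<Lambda> = distr cube_measure ?N (probe X)"
  interpret L: prob_space \<Lambda> unfolding \<Lambda>_def by (rule P.prob_space_distr[OF meas])
  let ?K = "range (probe X)"
  have Kc: "compactin (norm_topology ?V (Lip_norm X)) ?K" by (rule compactin_range_probe[OF X])
  then have "closedin M.mtopology ?K"
    unfolding top using M.Hausdorff_space_mtopology compactin_imp_closedin by blast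
  then have "openin M.mtopology (?V - ?K)" by (simp add: closedin_def)
  then have "?V - ?K \<in> sets ?N" unfolding setsN top by blast
  then have "?V - (?V - ?K) \<in> sets ?N" using sets.compl_sets[of "?V - ?K" ?N] spN by simp
  then have Ks: "?K \<in> sets ?N" using probe_in_Lip_space by (simp add: double_diff image_subsetI)
  have "emeasure \<Lambda> ?K = emeasure cube_measure (probe X -` ?K \<inter> space cube_measure)"
    unfolding \<Lambda>_def by (rule emeasure_distr[OF meas Ks])
  also have "probe X -` ?K \<inter> space cube_measure = space cube_measure" by auto
  finally have K1: "emeasure \<Lambda> ?K = 1" by (simp add: P.emeasure_space_1)
  have "0 \<in> ?V" using probe_in_Lip_space[of X "\<lambda>_. 0"] by (simp add: zero_fun_def)
  have "B \<in> sets ?N"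
  proof -
    have "{e \<in> ?V. 0 + e \<in> B} = B" using Bs by auto
    with B[OF \<open>0 \<in> ?V\<close>] show ?thesis by simp
  qed
  moreover have "AE e in \<Lambda>. v + e \<in> B" if "v \<in> ?V" for v
    unfolding \<Lambda>_def
    using ae[OF that] B[OF that] by (subst AE_distr_iff[OF meas]) (simp_all add: spN)
  moreover have "sets \<Lambda> = sets ?N" by (simp add: \<Lambda>_def)
  ultimately show ?thesis
    unfolding prevalent_borel_def using Kc K1 by (intro conjI exI[of _ \<Lambda>] exI[of _ ?K] ballI) auto
qed

section \<open>Null covers\<close>

text \<open>For \<open>q \<ge> 1\<close> this amounts to H^q(A) = 0. No bound on the diameters is
  imposed, since a small sum of q-th powers already forces each diameter to be small.\<close>

definition null_cover :: "nat \<Rightarrow> 'a::metric_space set \<Rightarrow> bool" where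
  "null_cover q A \<longleftrightarrow> (\<forall>\<epsilon>>0. \<exists>U :: nat \<Rightarrow> 'a set. A \<subseteq> (\<Union>i. U i) \<and> (\<forall>i. bounded (U i)) \<and>
     (\<Sum>i. ennreal (diameter (U i) ^ q)) < ennreal \<epsilon>)"

lemma null_cover_mono: "null_cover q A \<Longrightarrow> B \<subseteq> A \<Longrightarrow> null_cover q B"
  unfolding null_cover_def by (meson order_trans)

lemma null_cover_singleton: "null_cover 1 {y}"
  unfolding null_cover_def
proof (intro allI impI)
  fix \<epsilon> :: real assume "0 < \<epsilon>"
  then show "\<exists>U :: nat \<Rightarrow> 'a set. {y} \<subseteq> (\<Union>i. U i) \<and> (\<forall>i. bounded (U i)) \<and>
     (\<Sum>i. ennreal (diameter (U i) ^ 1)) < ennreal \<epsilon>"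
    by (intro exI[of _ "\<lambda>_. {y}"]) (auto simp: diameter_singleton)
qed

lemma null_cover_of_hausdorff_dim:
  assumes "hausdorff_dim A < ereal (real q)"
  shows "null_cover q A"
  unfolding null_cover_def
proof (intro allI impI)
  fix \<epsilon> :: real assume "0 < \<epsilon>"
  from assms obtain s where s: "0 \<le> s" "hausdorff_measure s A = 0" "s < real q"
    unfolding hausdorff_dim_def by (auto simp: INF_less_iff)
  have q: "0 < q" using s by (cases q) auto
  \<comment> \<open>Scale 1 is the right one: for diameters at most 1, raising the exponent from
    \<open>s\<close> to \<open>q\<close> only decreases the powers.\<close>
  have "hausdorff_premeasure s 1 A \<le> hausdorff_measure s A"
    unfolding hausdorff_measure_def by (rule SUP_upper) simp
  then have "hausdorff_premeasure s 1 A = 0" using s(2) by simp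
  then have "hausdorff_premeasure s 1 A < ennreal (min \<epsilon> 1)" using \<open>0 < \<epsilon>\<close> by (simp add: ennreal_less_zero_iff)
  then obtain U :: "nat \<Rightarrow> 'a set" where U: "A \<subseteq> (\<Union>i. U i)" "\<And>i. bounded (U i)"
      "\<And>i. diameter (U i) \<le> 1" "(\<Sum>i. diam_power s (U i)) < ennreal (min \<epsilon> 1)"
    unfolding hausdorff_premeasure_def by (auto simp: INF_less_iff simp del: ennreal_less_iff)
  have "ennreal (diameter (U i) ^ q) \<le> diam_power s (U i)" for i
  proof -
    have d: "0 \<le> diameter (U i)" by (rule diameter_ge_0[OF U(2)])
    show ?thesis
    proof (cases "U i = {} \<or> s = 0 \<or> diameter (U i) = 0")
      case True
      then show ?thesis
        using d U(3)[of i] q by (auto simp: diam_power_def power_le_one diameter_empty zero_power)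
    next
      case False
      then have "diameter (U i) ^ q = diameter (U i) powr real q"
        using d by (simp add: powr_realpow)
      also have "\<dots> \<le> diameter (U i) powr s"
        using False d U(3)[of i] s(3) by (intro powr_mono') auto
      finally show ?thesis using False by (simp add: diam_power_def ennreal_leI)
    qed
  qed
  then have "(\<Sum>i. ennreal (diameter (U i) ^ q)) \<le> (\<Sum>i. diam_power s (U i))"
    by (intro suminf_le) auto
  also note U(4)
  also have "ennreal (min \<epsilon> 1) \<le> ennreal \<epsilon>" by (intro ennreal_leI) simp
  finally show "\<exists>U :: nat \<Rightarrow> 'a set. A \<subseteq> (\<Union>i. U i) \<and> (\<forall>i. bounded (U i)) \<and>
     (\<Sum>i. ennreal (diameter (U i) ^ q)) < ennreal \<epsilon>"
    using U(1,2) by blast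
qed

lemma null_cover_of_hausdorff_dim_measure:
  assumes "hausdorff_dim_measure M < ereal (real q)"
  obtains A where "A \<in> sets borel" "emeasure M (space M - A) = 0" "null_cover q A"
proof -
  from assms obtain A where "A \<in> sets borel" "emeasure M (space M - A) = 0"
      "hausdorff_dim A < ereal (real q)"
    unfolding hausdorff_dim_measure_def by (auto simp: INF_less_iff)
  then show thesis using that null_cover_of_hausdorff_dim by blast
qed

section \<open>Probability that random coefficients hit prescribed targets\<close>

lemma unif_interval_le:
  "emeasure (uniform_measure lborel {-1..1}) {x. \<bar>x - w\<bar> \<le> r} \<le> ennreal r"
proof (cases "0 \<le> r")
  case True
  have e: "{x. \<bar>x - w\<bar> \<le> r} = {w - r..w + r}" by auto
  have "emeasure (uniform_measure lborel {-1..1}) {x. \<bar>x - w\<bar> \<le> r}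
      = emeasure lborel ({-1..1} \<inter> {w - r..w + r}) / emeasure lborel {-1..1::real}"
    unfolding e by simp
  also have "\<dots> \<le> emeasure lborel {w - r..w + r} / emeasure lborel {-1..1::real}"
    by (intro divide_right_mono_ennreal emeasure_mono) auto
  \<comment> \<open>The interval has length 2r and the uniform density is 1/2.\<close>
  also have "\<dots> = ennreal r"
    using True by (simp add: divide_ennreal flip: ennreal_numeral)
  finally show ?thesis .
next
  case False
  then have e: "{x. \<bar>x - w\<bar> \<le> r} = {}" using abs_ge_zero order_trans by fastforce
  show ?thesis unfolding e by simp
qed

lemma slab_sets:
  fixes W :: "nat \<Rightarrow> (nat \<Rightarrow> real) \<Rightarrow> real"
  assumes W: "\<And>i. i < n \<Longrightarrow> W i \<in> borel_measurable borel"
  shows "{\<alpha>. \<forall>i<n. \<bar>\<alpha> (j i) - W i \<alpha>\<bar> \<le> r} \<in> sets borel"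
proof (cases "n = 0")
  case False
  have "{\<alpha>. \<bar>\<alpha> (j i) - W i \<alpha>\<bar> \<le> r} \<in> sets borel" if "i < n" for i
  proof -
    have "(\<lambda>\<alpha>. \<alpha> (j i)) \<in> borel_measurable borel"
      by (intro borel_measurable_continuous_onI continuous_on_product_coordinates)
    then have "(\<lambda>\<alpha>. \<bar>\<alpha> (j i) - W i \<alpha>\<bar>) \<in> borel_measurable borel"
      using W[OF that] by (intro borel_measurable_abs borel_measurable_diff)
    from borel_measurable_le[OF this borel_measurable_const[of r]] show ?thesis by simp
  qed
  then have "(\<Inter>i\<in>{..<n}. {\<alpha>. \<bar>\<alpha> (j i) - W i \<alpha>\<bar> \<le> r}) \<in> sets borel"
    using False by (intro sets.finite_INT) auto
  also have "(\<Inter>i\<in>{..<n}. {\<alpha>. \<bar>\<alpha> (j i) - W i \<alpha>\<bar> \<le> r}) = {\<alpha>. \<forall>i<n. \<bar>\<alpha> (j i) - W i \<alpha>\<bar> \<le> r}"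
    by auto
  finally show ?thesis .
qed simp

text \<open>Resampling the coordinate \<open>j n\<close> does not affect the event for the earlier coordinates.\<close>

lemma cube_slab_bound:
  assumes W: "\<And>i. i < q \<Longrightarrow> W i \<in> borel_measurable borel"
    and j: "inj_on j {..<q}"
    and indep: "\<And>i l \<alpha> x. i < q \<Longrightarrow> l < q \<Longrightarrow> W i (\<alpha>(j l := x)) = W i \<alpha>"
    and n: "n \<le> q"
  shows "emeasure cube_measure {\<alpha>. \<forall>i<n. \<bar>\<alpha> (j i) - W i \<alpha>\<bar> \<le> r} \<le> ennreal r ^ n"
  using n
proof (induction n)
  case 0
  then show ?case
    using prob_space.emeasure_le_1[OF prob_space_cube] by simp
next
  case (Suc n)
  interpret U: prob_space "uniform_measure lborel {-1..1::real}" by (rule prob_space_unif)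
  interpret P: prob_space cube_measure by (rule prob_space_cube)
  interpret UP: pair_prob_space "uniform_measure lborel {-1..1::real}" cube_measure ..
  let ?U = "uniform_measure lborel {-1..1::real}"
  define G where "G n = {\<alpha>. \<forall>i<n. \<bar>\<alpha> (j i) - W i \<alpha>\<bar> \<le> r}" for n
  have G: "G m \<in> sets borel" if "m \<le> q" for m
    unfolding G_def using that by (intro slab_sets W) simp
  have n: "n < q" using Suc.prems by simp
  have meas: "(\<lambda>(x, \<alpha>). \<alpha>(j n := x)) \<in> measurable (?U \<Otimes>\<^sub>M cube_measure) cube_measure"
    unfolding cube_measure_def case_prod_beta
    by (rule measurable_fun_upd[where J = UNIV]) measurable
  \<comment> \<open>Overwriting one coordinate by an independent uniform variable leaves the product
    law unchanged. Integrating over that variable first, with the target \<open>W n \<alpha>\<close>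
    held fixed, yields one factor \<open>r\<close>.\<close>
  have resample: "cube_measure = distr (?U \<Otimes>\<^sub>M cube_measure) cube_measure (\<lambda>(x, \<alpha>). \<alpha>(j n := x))"
    using distr_pair_PiM_eq_PiM[of UNIV "\<lambda>_. ?U" "j n"] prob_space_unif
    by (simp add: cube_measure_def)
  have upd: "\<alpha>(j n := x) \<in> G (Suc n) \<longleftrightarrow> \<alpha> \<in> G n \<and> \<bar>x - W n \<alpha>\<bar> \<le> r" for \<alpha> x
  proof -
    have "j i \<noteq> j n" if "i < n" for i using j n that by (auto dest: inj_onD)
    then show ?thesis
      using n by (auto simp: G_def less_Suc_eq indep)
  qed
  have GS: "G (Suc n) \<in> sets cube_measure" "G n \<in> sets cube_measure"
    using G[of "Suc n"] G[of n] Suc.prems n by (simp_all add: sets_cube)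
  have "emeasure cube_measure (G (Suc n)) =
      emeasure (?U \<Otimes>\<^sub>M cube_measure) ((\<lambda>(x, \<alpha>). \<alpha>(j n := x)) -` G (Suc n) \<inter> space (?U \<Otimes>\<^sub>M cube_measure))"
    by (subst resample) (rule emeasure_distr[OF meas GS(1)])
  also have "\<dots> = (\<integral>\<^sup>+\<alpha>. emeasure ?U ((\<lambda>x. (x, \<alpha>)) -`
      ((\<lambda>(x, \<alpha>). \<alpha>(j n := x)) -` G (Suc n) \<inter> space (?U \<Otimes>\<^sub>M cube_measure))) \<partial>cube_measure)"
    by (intro UP.emeasure_pair_measure_alt2 measurable_sets[OF meas] GS)
  also have "\<dots> \<le> (\<integral>\<^sup>+\<alpha>. ennreal r * indicator (G n) \<alpha> \<partial>cube_measure)"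
  proof (rule nn_integral_mono)
    fix \<alpha>
    have sub: "(\<lambda>x. (x, \<alpha>)) -` ((\<lambda>(x, \<alpha>). \<alpha>(j n := x)) -` G (Suc n) \<inter> space (?U \<Otimes>\<^sub>M cube_measure))
        \<subseteq> (if \<alpha> \<in> G n then {x. \<bar>x - W n \<alpha>\<bar> \<le> r} else {})"
      using upd by auto
    have "{x. \<bar>x - W n \<alpha>\<bar> \<le> r} \<in> sets ?U" by simp
    with sub have "emeasure ?U ((\<lambda>x. (x, \<alpha>)) -` ((\<lambda>(x, \<alpha>). \<alpha>(j n := x)) -` G (Suc n) \<inter> space (?U \<Otimes>\<^sub>M cube_measure)))
        \<le> emeasure ?U (if \<alpha> \<in> G n then {x. \<bar>x - W n \<alpha>\<bar> \<le> r} else {})"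
      by (intro emeasure_mono) (auto split: if_splits)
    also have "\<dots> \<le> ennreal r * indicator (G n) \<alpha>"
      using unif_interval_le[of "W n \<alpha>" r] by (auto split: split_indicator)
    finally show "emeasure ?U ((\<lambda>x. (x, \<alpha>)) -` ((\<lambda>(x, \<alpha>). \<alpha>(j n := x)) -` G (Suc n) \<inter> space (?U \<Otimes>\<^sub>M cube_measure)))
        \<le> ennreal r * indicator (G n) \<alpha>" .
  qed
  also have "\<dots> = ennreal r * emeasure cube_measure (G n)"
    using GS(2) by (simp add: nn_integral_cmult)
  also have "\<dots> \<le> ennreal r * ennreal r ^ n"
    using Suc.IH n by (intro mult_left_mono) (auto simp: G_def)
  finally show ?case by (simp add: G_def)
qed

text \<open>Given the other coefficients, the target vector is a Lipschitz image of
  \<open>Y\<close>, hence Lebesgue null in dimension q. Quantitatively, a covering set of diameter d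
  allows hits only inside a slab of probability at most \<open>(L * d) ^ q\<close>, up to raising
  \<open>L\<close> to at least 1.\<close>

lemma AE_not_hit:
  fixes Y :: "'a::metric_space set" and W :: "nat \<Rightarrow> 'a \<Rightarrow> (nat \<Rightarrow> real) \<Rightarrow> real"
  assumes Y: "null_cover q Y"
    and W: "\<And>i y. i < q \<Longrightarrow> y \<in> Y \<Longrightarrow> W i y \<in> borel_measurable borel"
    and j: "inj_on j {..<q}"
    and indep: "\<And>i l y \<alpha> x. i < q \<Longrightarrow> l < q \<Longrightarrow> y \<in> Y \<Longrightarrow> W i y (\<alpha>(j l := x)) = W i y \<alpha>"
    and lip: "\<And>i \<alpha> y z. i < q \<Longrightarrow> y \<in> Y \<Longrightarrow> z \<in> Y \<Longrightarrow> \<bar>W i y \<alpha> - W i z \<alpha>\<bar> \<le> L * dist y z"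
  shows "AE \<alpha> in cube_measure. \<not> (\<exists>y\<in>Y. \<forall>i<q. \<alpha> (j i) = W i y \<alpha>)"
proof -
  define L' where "L' = max L 1"
  have L': "1 \<le> L'" "L \<le> L'" by (auto simp: L'_def)
  let ?H = "{\<alpha>. \<exists>y\<in>Y. \<forall>i<q. \<alpha> (j i) = W i y \<alpha>}"
  have "\<exists>G. G \<in> sets cube_measure \<and> ?H \<subseteq> G \<and> emeasure cube_measure G \<le> ennreal (1 / real (Suc m))" for m
  proof -
    \<comment> \<open>Chosen to cancel the factor \<open>L' ^ q\<close> in the slab probabilities;
      taking \<open>L' \<ge> 1\<close> makes the division legitimate whatever the sign of
      \<open>L\<close>.\<close>
    define \<epsilon> where "\<epsilon> = 1 / real (Suc m) / L' ^ q"
    have "0 < \<epsilon>" using L' by (simp add: \<epsilon>_def)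
    with Y obtain U :: "nat \<Rightarrow> 'a set" where U: "Y \<subseteq> (\<Union>i. U i)" "\<And>i. bounded (U i)"
        "(\<Sum>i. ennreal (diameter (U i) ^ q)) < ennreal \<epsilon>"
      unfolding null_cover_def by blast
    \<comment> \<open>Covering sets may stick out of \<open>Y\<close>, but the targets are
      controlled only on \<open>Y\<close>; so the slab is centred at a point of the
      intersection.\<close>
    define y where "y n = (SOME y. y \<in> U n \<inter> Y)" for n
    have y: "y n \<in> U n \<inter> Y" if "U n \<inter> Y \<noteq> {}" for n
      unfolding y_def using that by (metis ex_in_conv someI_ex)
    define G where "G n = (if U n \<inter> Y = {} then {} else
      {\<alpha>. \<forall>i<q. \<bar>\<alpha> (j i) - W i (y n) \<alpha>\<bar> \<le> L' * diameter (U n)})" for n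
    have Gs: "G n \<in> sets cube_measure" for n
    proof (cases "U n \<inter> Y = {}")
      case False
      with y[of n] have "y n \<in> Y" by blast
      with False show ?thesis unfolding G_def sets_cube by (simp only: if_False) (intro slab_sets W)
    qed (simp add: G_def)
    have "?H \<subseteq> (\<Union>n. G n)"
    proof
      fix \<alpha> assume "\<alpha> \<in> ?H"
      then obtain z where z: "z \<in> Y" "\<And>i. i < q \<Longrightarrow> \<alpha> (j i) = W i z \<alpha>" by blast
      then obtain n where n: "z \<in> U n" using U(1) by blast
      then have ne: "U n \<inter> Y \<noteq> {}" using z(1) by blast
      have "\<bar>\<alpha> (j i) - W i (y n) \<alpha>\<bar> \<le> L' * diameter (U n)" if "i < q" for i
      proof -
        have "\<bar>\<alpha> (j i) - W i (y n) \<alpha>\<bar> \<le> L * dist z (y n)"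
          using lip[OF that z(1), of "y n" \<alpha>] y[OF ne] z(2)[OF that] by simp
        also have "\<dots> \<le> L' * dist z (y n)" using L' by (intro mult_right_mono) auto
        also have "\<dots> \<le> L' * diameter (U n)"
          using L' diameter_bounded_bound[OF U(2) n, of "y n"] y[OF ne] by (intro mult_left_mono) auto
        finally show ?thesis .
      qed
      then have "\<alpha> \<in> G n" using ne by (simp add: G_def)
      then show "\<alpha> \<in> (\<Union>n. G n)" by blast
    qed
    moreover have "emeasure cube_measure (\<Union>n. G n) \<le> ennreal (1 / real (Suc m))"
    proof -
      have "emeasure cube_measure (G n) \<le> ennreal (L' ^ q) * ennreal (diameter (U n) ^ q)" for n
      proof (cases "U n \<inter> Y = {}")
        case False
        have "emeasure cube_measure (G n) \<le> ennreal (L' * diameter (U n)) ^ q"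
          using False y[OF False] W j indep unfolding G_def
          by simp (intro cube_slab_bound[where q = q], auto)
        also have "\<dots> = ennreal (L' ^ q) * ennreal (diameter (U n) ^ q)"
          using L' diameter_ge_0[OF U(2)] by (simp add: ennreal_power ennreal_mult power_mult_distrib)
        finally show ?thesis .
      qed (simp add: G_def)
      then have "(\<Sum>n. emeasure cube_measure (G n)) \<le> (\<Sum>n. ennreal (L' ^ q) * ennreal (diameter (U n) ^ q))"
        by (intro suminf_le) auto
      also have "\<dots> = ennreal (L' ^ q) * (\<Sum>n. ennreal (diameter (U n) ^ q))"
        by (rule ennreal_suminf_cmult)
      also have "\<dots> \<le> ennreal (L' ^ q) * ennreal \<epsilon>"
        using U(3) by (intro mult_left_mono) auto
      also have "\<dots> = ennreal (1 / real (Suc m))"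
        using L' by (simp add: \<epsilon>_def flip: ennreal_mult)
      finally show ?thesis
        using emeasure_subadditive_countably[of G cube_measure] Gs by (auto intro: order_trans)
    qed
    moreover have "(\<Union>n. G n) \<in> sets cube_measure" using Gs by auto
    ultimately show ?thesis by blast
  qed
  then have "\<exists>G. \<forall>m. G m \<in> sets cube_measure \<and> ?H \<subseteq> G m \<and>
      emeasure cube_measure (G m) \<le> ennreal (1 / real (Suc m))"
    by (intro choice allI)
  then obtain G where G: "\<And>m. G m \<in> sets cube_measure" "\<And>m. ?H \<subseteq> G m"
      "\<And>m. emeasure cube_measure (G m) \<le> ennreal (1 / real (Suc m))"
    by (elim exE) (simp only: all_conj_distrib, blast)
  \<comment> \<open>The set of hits is an uncountable union and need not be measurable, so it is
    enclosed in a measurable null set.\<close>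
  have I: "(\<Inter>m. G m) \<in> sets cube_measure" using G(1) by auto
  have "emeasure cube_measure (\<Inter>m. G m) \<le> ennreal (1 / real (Suc m))" for m
    using G(3)[of m] emeasure_mono[of "\<Inter>m. G m" "G m" cube_measure] G(1)[of m]
    by (auto intro: order_trans)
  moreover have "(\<lambda>m. ennreal (1 / real (Suc m))) \<longlonglongrightarrow> ennreal 0"
    by (intro tendsto_ennrealI LIMSEQ_Suc[OF lim_1_over_n])
  ultimately have "emeasure cube_measure (\<Inter>m. G m) \<le> ennreal 0"
    by (intro LIMSEQ_le_const) auto
  with I have "(\<Inter>m. G m) \<in> null_sets cube_measure" by auto
  then show ?thesis by (rule AE_I') (use G(2) in auto)
qed

section \<open>Collisions with a fixed point\<close>

lemma funpow_in:
  assumes "T \<in> X \<rightarrow> X" "x \<in> X"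
  shows "(T ^^ n) x \<in> X"
  using assms by (induction n) auto

lemma inj_on_funpow:
  assumes "T \<in> X \<rightarrow> X" "inj_on T X"
  shows "inj_on (T ^^ n) X"
proof (induction n)
  case (Suc n)
  show ?case
  proof (rule inj_onI)
    fix x y assume xy: "x \<in> X" "y \<in> X" "(T ^^ Suc n) x = (T ^^ Suc n) y"
    then have "(T ^^ n) x = (T ^^ n) y"
      using inj_onD[OF assms(2)] funpow_in[OF assms(1)] by simp
    with xy Suc show "x = y" by (auto dest: inj_onD)
  qed
qed simp

lemma funpow_period:
  assumes "T \<in> X \<rightarrow> X" "inj_on T X" "y \<in> X" "(T ^^ i) y = (T ^^ l) y" "i \<le> l"
  shows "(T ^^ (l - i)) y = y"
proof -
  have "(T ^^ i) ((T ^^ (l - i)) y) = (T ^^ i) y"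
    using assms(4,5) by (metis funpow_add comp_apply le_add_diff_inverse)
  then show ?thesis
    using inj_onD[OF inj_on_funpow[OF assms(1,2)]] funpow_in[OF assms(1,3)] assms(3) by blast
qed

text \<open>Injectivity lets iterates be cancelled from a repetition, so a repetition among the
  first \<open>k\<close> iterates makes \<open>y\<close> periodic rather than only eventually
  periodic. Below the least period no iterate repeats.\<close>

lemma minimal_period:
  assumes "T \<in> X \<rightarrow> X" "inj_on T X" "y \<in> X" "\<not> inj_on (\<lambda>i. (T ^^ i) y) {..<k}"
  obtains q where "q \<in> {1..<k}" "(T ^^ q) y = y" "inj_on (\<lambda>i. (T ^^ i) y) {..<q}"
proof -
  define P where "P n \<longleftrightarrow> 0 < n \<and> (T ^^ n) y = y" for n
  have P: "P (l - i)" if "i < l" "(T ^^ i) y = (T ^^ l) y" for i l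
    using funpow_period[OF assms(1-3) that(2)] that(1) by (auto simp: P_def)
  from assms(4) obtain i l where "i < k" "l < k" "i \<noteq> l" "(T ^^ i) y = (T ^^ l) y"
    by (auto simp: inj_on_def)
  then obtain i l where il: "i < l" "l < k" "(T ^^ i) y = (T ^^ l) y"
    by (metis linorder_neqE_nat)
  define q where "q = (LEAST n. P n)"
  have "P q" unfolding q_def using P[OF il(1,3)] by (rule LeastI)
  have least: "q \<le> n" if "P n" for n unfolding q_def using that by (rule Least_le)
  have "inj_on (\<lambda>i. (T ^^ i) y) {..<q}"
  proof (rule linorder_inj_onI)
    fix i l assume "i < l" "i \<in> {..<q}" "l \<in> {..<q}"
    then show "(T ^^ i) y \<noteq> (T ^^ l) y" using P[of i l] least[of "l - i"] by auto
  qed auto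
  moreover have "q \<in> {1..<k}" using least[OF P[OF il(1,3)]] il \<open>P q\<close> by (auto simp: P_def)
  ultimately show thesis using that \<open>P q\<close> by (auto simp: P_def)
qed

lemma lipschitz_on_funpow:
  assumes "T \<in> X \<rightarrow> X" "L-lipschitz_on X T"
  shows "(L ^ n)-lipschitz_on X (T ^^ n)"
proof (induction n)
  case 0
  show ?case by (auto simp: lipschitz_on_def)
next
  case (Suc n)
  have "(L ^ n * L)-lipschitz_on X ((T ^^ n) \<circ> T)"
    using assms by (intro lipschitz_on_compose[OF assms(2)] lipschitz_on_subset[OF Suc]) auto
  then show ?case by (simp only: funpow_Suc_right power_Suc2)
qed

context bump_family
begin

lemma borel_measurable_probe:
  assumes "\<And>j. (\<lambda>\<alpha>. f \<alpha> j) \<in> borel_measurable M"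
  shows "(\<lambda>\<alpha>. probe X (f \<alpha>) z) \<in> borel_measurable M"
proof (cases "z \<in> X")
  case True
  have "(\<lambda>\<alpha>. clip (f \<alpha> j)) \<in> borel_measurable M" for j
    unfolding clip_def using assms[of j] by (intro borel_measurable_max borel_measurable_min) auto
  then have "(\<lambda>\<alpha>. \<Sum>j. clip (f \<alpha> j) * p j z) \<in> borel_measurable M"
    by (intro borel_measurable_suminf borel_measurable_times) auto
  then show ?thesis using True by (simp add: probe_def)
qed (simp add: probe_def)

text \<open>Separates the coefficients to be solved for from a remainder that does not change when
  they are resampled.\<close>

lemma probe_split:
  assumes "z \<in> X" "finite J"
  shows "probe X \<alpha> z = probe X (\<lambda>j. if j \<in> J then 0 else \<alpha> j) z + (\<Sum>j\<in>J. clip (\<alpha> j) * p j z)"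
proof -
  let ?\<alpha> = "\<lambda>j. if j \<in> J then 0 else \<alpha> j"
  have "(\<Sum>j. clip (\<alpha> j) * p j z) - (\<Sum>j. clip (?\<alpha> j) * p j z)
      = (\<Sum>j. clip (\<alpha> j) * p j z - clip (?\<alpha> j) * p j z)"
    by (rule suminf_diff[OF summable_probe summable_probe])
  also have "\<dots> = (\<Sum>j\<in>J. clip (\<alpha> j) * p j z - clip (?\<alpha> j) * p j z)"
    using assms(2) by (intro suminf_finite) auto
  also have "\<dots> = (\<Sum>j\<in>J. clip (\<alpha> j) * p j z)" by (intro sum.cong) auto
  finally show ?thesis using assms(1) by (simp add: probe_def)
qed

text \<open>There are only countably many lists of bump indices, and each \<open>y\<close> is
  handled by one whose i-th bump peaks at the i-th iterate of \<open>y\<close> and vanishes at the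
  other iterates of \<open>x\<close> and \<open>y\<close>. For a fixed list the collision equations
  are diagonal in the chosen coefficients.\<close>

lemma AE_no_collision_null_cover:
  assumes T: "T \<in> X \<rightarrow> X" "L-lipschitz_on X T"
    and v: "v \<in> Lip_space X" and x: "x \<in> X" and Y: "Y \<subseteq> X" "null_cover q Y"
    and inj: "\<And>y. y \<in> Y \<Longrightarrow> inj_on (\<lambda>i. (T ^^ i) y) {..<q}"
    and disj: "\<And>y i l. y \<in> Y \<Longrightarrow> i < q \<Longrightarrow> l < q \<Longrightarrow> (T ^^ i) x \<noteq> (T ^^ l) y"
  shows "AE \<alpha> in cube_measure. \<not> (\<exists>y\<in>Y. \<forall>i<q.
    (v + probe X \<alpha>) ((T ^^ i) x) = (v + probe X \<alpha>) ((T ^^ i) y))"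
proof -
  define Z where "Z js = {y \<in> Y. \<forall>i<q. p (js ! i) ((T ^^ i) y) = c (js ! i) \<and>
    (\<forall>l<q. p (js ! i) ((T ^^ l) x) = 0) \<and> (\<forall>l<q. l \<noteq> i \<longrightarrow> p (js ! i) ((T ^^ l) y) = 0)}" for js
  have cover: "\<exists>js. length js = q \<and> y \<in> Z js" if y: "y \<in> Y" for y
  proof -
    let ?F = "(\<lambda>i. (T ^^ i) x) ` {..<q} \<union> (\<lambda>i. (T ^^ i) y) ` {..<q}"
    have "\<exists>j. p j ((T ^^ i) y) = c j \<and> (\<forall>z\<in>?F - {(T ^^ i) y}. p j z = 0)" for i
      by (rule p_isolates) auto
    then obtain f where f: "\<And>i. p (f i) ((T ^^ i) y) = c (f i)"
        "\<And>i z. z \<in> ?F - {(T ^^ i) y} \<Longrightarrow> p (f i) z = 0"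
      by metis
    have "p (f i) ((T ^^ l) x) = 0" if "i < q" "l < q" for i l
      using f(2)[of "(T ^^ l) x" i] disj[OF y that(2,1)] that by auto
    moreover have "p (f i) ((T ^^ l) y) = 0" if "i < q" "l < q" "l \<noteq> i" for i l
      using f(2)[of "(T ^^ l) y" i] inj[OF y] that by (auto dest: inj_onD)
    ultimately have "y \<in> Z (map f [0..<q])" using y f(1) by (auto simp: Z_def)
    then show ?thesis by (intro exI[of _ "map f [0..<q]"]) auto
  qed
  have "AE \<alpha> in cube_measure. length js = q \<longrightarrow> \<not> (\<exists>y\<in>Z js. \<forall>i<q.
    (v + probe X \<alpha>) ((T ^^ i) x) = (v + probe X \<alpha>) ((T ^^ i) y))" for js
  \<comment> \<open>A point of \<open>Z js\<close> shows that the indices in \<open>js\<close> are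
    distinct; empty pieces are trivial.\<close>
  proof (cases "length js = q \<and> Z js \<noteq> {}")
    case True
    then have len: "length js = q" by simp
    define J where "J = set js"
    have js_in: "js ! i \<in> J" if "i < q" for i using that len by (simp add: J_def)
    define j where "j i = js ! i" for i
    from True obtain y0 where y0: "y0 \<in> Z js" by blast
    have inj_j: "inj_on j {..<q}"
    proof (rule inj_onI, rule ccontr)
      fix i l assume il: "i \<in> {..<q}" "l \<in> {..<q}" "j i = j l" "i \<noteq> l"
      have "p (j i) ((T ^^ i) y0) = c (j i)" using y0 il(1) unfolding Z_def j_def by blast
      moreover have "p (j l) ((T ^^ i) y0) = 0" using y0 il(1,2,4) unfolding Z_def j_def by blast
      ultimately show False using il(3) c_pos[of "j i"] by simp
    qed
    define \<alpha>0 where "\<alpha>0 \<alpha> = (\<lambda>j. if j \<in> J then 0 else \<alpha> j)" for \<alpha> :: "nat \<Rightarrow> real"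
    define u where "u \<alpha> z = v z + probe X (\<alpha>0 \<alpha>) z" for \<alpha> z
    \<comment> \<open>The i-th collision equation reads \<open>u \<alpha> ((T ^^ i) x) = u \<alpha>
      ((T ^^ i) y) + \<alpha> (j i) * c (j i)\<close>; this is its solution for
      \<open>\<alpha> (j i)\<close>.\<close>
    define W where "W i y \<alpha> = (u \<alpha> ((T ^^ i) x) - u \<alpha> ((T ^^ i) y)) / c (j i)" for i y \<alpha>
    define Lv where "Lv = Lip_const X v"
    have Lv: "Lv-lipschitz_on X v" unfolding Lv_def by (rule Lip_const_lipschitz_on[OF v])
    have "0 \<le> L" using T(2) by (rule lipschitz_on_nonneg)
    have "0 \<le> Lv" using Lv by (rule lipschitz_on_nonneg)
    have u_lip: "(Lv + 4)-lipschitz_on X (u \<alpha>)" for \<alpha>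
      unfolding u_def by (rule lipschitz_on_add[OF Lv probe_lipschitz])
    \<comment> \<open>A common Lipschitz constant, since a sum of nonnegative terms dominates each
      of them. It involves the heights \<open>c (j i)\<close> and so is available only on a single
      piece \<open>Z js\<close>.\<close>
    define L' where "L' = (\<Sum>i<q. (Lv + 4) * L ^ i / c (j i))"
    have sub: "Z js \<subseteq> Y" by (auto simp: Z_def)
    have "AE \<alpha> in cube_measure. \<not> (\<exists>y\<in>Z js. \<forall>i<q. \<alpha> (j i) = W i y \<alpha>)"
    proof (rule AE_not_hit[where L = L'])
      show "null_cover q (Z js)" using Y(2) sub by (rule null_cover_mono)
      show "inj_on j {..<q}" by (rule inj_j)
      show "W i y (\<alpha>(j l := t)) = W i y \<alpha>" if "l < q" for i l y \<alpha> t
      proof -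
        have "\<alpha>0 (\<alpha>(j l := t)) = \<alpha>0 \<alpha>" using js_in[OF that] by (auto simp: \<alpha>0_def j_def)
        then show ?thesis by (simp add: W_def u_def)
      qed
      show "W i y \<in> borel_measurable borel" for i y
      proof -
        have "(\<lambda>\<alpha>. \<alpha>0 \<alpha> j) \<in> borel_measurable borel" for j
          unfolding \<alpha>0_def
          by (cases "j \<in> J") (auto intro!: borel_measurable_continuous_onI continuous_on_product_coordinates)
        then have "(\<lambda>\<alpha>. u \<alpha> z) \<in> borel_measurable borel" for z
          unfolding u_def by (intro borel_measurable_add borel_measurable_probe) auto
        then have "(\<lambda>\<alpha>. W i y \<alpha>) \<in> borel_measurable borel"
          unfolding W_def by (intro borel_measurable_divide borel_measurable_diff) auto
        then show ?thesis by simp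
      qed
      show "\<bar>W i y \<alpha> - W i z \<alpha>\<bar> \<le> L' * dist y z" if i: "i < q" and "y \<in> Z js" "z \<in> Z js" for i y z \<alpha>
      proof -
        have yz: "y \<in> X" "z \<in> X" using that sub Y(1) by auto
        have "\<bar>W i y \<alpha> - W i z \<alpha>\<bar> = dist (u \<alpha> ((T ^^ i) y)) (u \<alpha> ((T ^^ i) z)) / c (j i)"
          using c_pos[of "j i"] unfolding W_def dist_real_def
          by (simp add: abs_minus_commute flip: diff_divide_distrib)
        also have "\<dots> \<le> (Lv + 4) * dist ((T ^^ i) y) ((T ^^ i) z) / c (j i)"
          using lipschitz_onD[OF u_lip funpow_in[OF T(1) yz(1)] funpow_in[OF T(1) yz(2)]] c_pos[of "j i"]
          by (simp add: divide_right_mono)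
        also have "\<dots> \<le> (Lv + 4) * (L ^ i * dist y z) / c (j i)"
          using lipschitz_onD[OF lipschitz_on_funpow[OF T] yz] c_pos[of "j i"] \<open>0 \<le> Lv\<close>
          by (intro divide_right_mono mult_left_mono) auto
        also have "\<dots> = (Lv + 4) * L ^ i / c (j i) * dist y z" by simp
        also have "\<dots> \<le> L' * dist y z"
          unfolding L'_def using i c_pos \<open>0 \<le> L\<close> \<open>0 \<le> Lv\<close>
          by (intro mult_right_mono member_le_sum) (auto intro!: divide_nonneg_pos)
        finally show ?thesis .
      qed
    qed
    \<comment> \<open>Almost surely all coefficients lie in [-1,1], where \<open>clip\<close> is the
      identity and the equations are linear.\<close>
    with AE_cube show ?thesis
    proof eventually_elim
      case (elim \<alpha>)
      show ?case
      proof (intro impI notI)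
        assume "\<exists>y\<in>Z js. \<forall>i<q. (v + probe X \<alpha>) ((T ^^ i) x) = (v + probe X \<alpha>) ((T ^^ i) y)"
        then obtain y where y: "y \<in> Z js"
          and eq: "\<And>i. i < q \<Longrightarrow> (v + probe X \<alpha>) ((T ^^ i) x) = (v + probe X \<alpha>) ((T ^^ i) y)"
          by blast
        have "\<alpha> (j i) = W i y \<alpha>" if i: "i < q" for i
        proof -
          have inX: "(T ^^ i) x \<in> X" "(T ^^ i) y \<in> X"
            using y sub Y(1) x by (auto intro!: funpow_in[OF T(1)])
          have "p a ((T ^^ i) x) = 0" if "a \<in> J" for a
            using that y i len by (auto simp: J_def Z_def in_set_conv_nth)
          then have 1: "probe X \<alpha> ((T ^^ i) x) = probe X (\<alpha>0 \<alpha>) ((T ^^ i) x)"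
            using probe_split[OF inX(1), of J \<alpha>] by (simp add: J_def \<alpha>0_def)
          have "p a ((T ^^ i) y) = 0" if "a \<in> J - {j i}" for a
            using that y i len by (auto simp: J_def Z_def in_set_conv_nth j_def)
          then have "(\<Sum>a\<in>J. clip (\<alpha> a) * p a ((T ^^ i) y)) = clip (\<alpha> (j i)) * p (j i) ((T ^^ i) y)"
            using js_in[OF i] by (subst sum.remove[of _ "j i"]) (auto simp: J_def j_def)
          also have "\<dots> = \<alpha> (j i) * c (j i)"
            using y i elim(1) by (simp add: Z_def j_def clip_id)
          finally have 2: "probe X \<alpha> ((T ^^ i) y) = probe X (\<alpha>0 \<alpha>) ((T ^^ i) y) + \<alpha> (j i) * c (j i)"
            using probe_split[OF inX(2), of J \<alpha>] by (simp add: J_def \<alpha>0_def)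
          show ?thesis
            using eq[OF i] c_pos[of "j i"] unfolding W_def u_def by (simp add: 1 2 field_simps)
        qed
        with elim(2) y show False by blast
      qed
    qed
  qed auto
  then have "AE \<alpha> in cube_measure. \<forall>js. length js = q \<longrightarrow> \<not> (\<exists>y\<in>Z js. \<forall>i<q.
    (v + probe X \<alpha>) ((T ^^ i) x) = (v + probe X \<alpha>) ((T ^^ i) y))"
    by (subst AE_all_countable) blast
  then show ?thesis
  proof eventually_elim
    case (elim \<alpha>)
    show ?case
    proof (rule notI, elim bexE)
      fix y assume y: "y \<in> Y" "\<forall>i<q. (v + probe X \<alpha>) ((T ^^ i) x) = (v + probe X \<alpha>) ((T ^^ i) y)"
      from cover[OF y(1)] obtain js where "length js = q" "y \<in> Z js" by blast
      with elim y(2) show False by blast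
    qed
  qed
qed

lemma AE_no_collision:
  assumes T: "T \<in> X \<rightarrow> X" "inj_on T X" "L-lipschitz_on X T"
    and v: "v \<in> Lip_space X" and x: "x \<in> X" and k: "1 \<le> k"
    and A: "A \<subseteq> X" "null_cover k A" "\<And>q. q \<in> {1..<k} \<Longrightarrow> null_cover q (A \<inter> Per q T X)"
  shows "AE \<alpha> in cube_measure. \<not> (\<exists>y\<in>A. y \<noteq> x \<and> (\<forall>i<k.
    (v + probe X \<alpha>) ((T ^^ i) x) = (v + probe X \<alpha>) ((T ^^ i) y)))"
proof -
  let ?hit = "\<lambda>\<alpha> y q. \<forall>i<q. (v + probe X \<alpha>) ((T ^^ i) x) = (v + probe X \<alpha>) ((T ^^ i) y)"
  \<comment> \<open>Here an iterate of \<open>y\<close> cannot be separated from the iterates of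
    \<open>x\<close>. As powers of \<open>T\<close> are injective, each pair of exponents allows at
    most one such \<open>y\<close>, and the single equation at time 0 rules it out, because
    \<open>y \<noteq> x\<close>.\<close>
  define C where "C = (\<Union>i\<in>{..<k}. \<Union>l\<in>{..<k}. {y \<in> A. y \<noteq> x \<and> (T ^^ i) x = (T ^^ l) y})"
  \<comment> \<open>For \<open>q < k\<close> fewer equations are tested against a smaller set: a
    collision at \<open>k\<close> times contains one at the first \<open>q\<close> times, and the
    points of period \<open>q\<close> are null for H^q.\<close>
  define Y where "Y q = {y \<in> (if q = k then A else A \<inter> Per q T X).
    inj_on (\<lambda>i. (T ^^ i) y) {..<q} \<and> (\<forall>i<q. \<forall>l<q. (T ^^ i) x \<noteq> (T ^^ l) y)}" for q
  have "finite {y \<in> A. y \<noteq> x \<and> (T ^^ i) x = (T ^^ l) y}" for i l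
  proof (rule finite_subset)
    show "{y \<in> A. y \<noteq> x \<and> (T ^^ i) x = (T ^^ l) y} \<subseteq> (T ^^ l) -` {(T ^^ i) x} \<inter> X"
      using A(1) by auto
    show "finite ((T ^^ l) -` {(T ^^ i) x} \<inter> X)"
      by (rule finite_vimage_IntI) (auto intro: inj_on_funpow[OF T(1,2)])
  qed
  then have "finite C" unfolding C_def by blast
  moreover have "AE \<alpha> in cube_measure. \<not> ?hit \<alpha> y 1" if "y \<in> C" for y
  proof -
    have "y \<in> X" "x \<noteq> y" using that A(1) by (auto simp: C_def)
    then show ?thesis
      using AE_no_collision_null_cover[OF T(1,3) v x, of "{y}" 1] null_cover_singleton[of y]
      by (simp add: inj_on_def)
  qed
  ultimately have "AE \<alpha> in cube_measure. \<forall>y\<in>C. \<not> ?hit \<alpha> y 1"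
    by (simp add: AE_finite_all)
  moreover have "AE \<alpha> in cube_measure. \<forall>q\<in>{1..k}. \<not> (\<exists>y\<in>Y q. ?hit \<alpha> y q)"
  proof -
    have "AE \<alpha> in cube_measure. \<not> (\<exists>y\<in>Y q. ?hit \<alpha> y q)" if "q \<in> {1..k}" for q
    proof (rule AE_no_collision_null_cover[OF T(1,3) v x])
      show "Y q \<subseteq> X" using A(1) by (auto simp: Y_def)
      have "null_cover q (if q = k then A else A \<inter> Per q T X)" using A(2,3) that by auto
      then show "null_cover q (Y q)" by (rule null_cover_mono) (auto simp: Y_def)
    qed (auto simp: Y_def)
    then show ?thesis by (subst AE_finite_all) auto
  qed
  ultimately show ?thesis
  proof eventually_elim
    case (elim \<alpha>)
    show ?case
    proof (rule notI, elim bexE conjE)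
      fix y assume y: "y \<in> A" "y \<noteq> x" "?hit \<alpha> y k"
      show False
      proof (cases "y \<in> C")
        case True
        moreover have "?hit \<alpha> y 1" using y(3) k by auto
        ultimately show False using elim(1) by blast
      next
        case False
        then have disj: "(T ^^ i) x \<noteq> (T ^^ l) y" if "i < k" "l < k" for i l
          using y(1,2) that unfolding C_def by blast
        have "\<exists>q\<in>{1..k}. y \<in> Y q"
        proof (cases "inj_on (\<lambda>i. (T ^^ i) y) {..<k}")
          case True
          with disj y(1) k show ?thesis by (intro bexI[of _ k]) (auto simp: Y_def)
        next
          case False
          have "y \<in> X" using y(1) A(1) by blast
          from minimal_period[OF T(1,2) this False] obtain q where
            q: "q \<in> {1..<k}" "(T ^^ q) y = y" "inj_on (\<lambda>i. (T ^^ i) y) {..<q}" .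
          then have "y \<in> Y q" using disj y(1) \<open>y \<in> X\<close> by (auto simp: Y_def Per_def)
          with q(1) show ?thesis by (intro bexI[of _ q]) auto
        qed
        then obtain q where q: "q \<in> {1..k}" "y \<in> Y q" by blast
        moreover have "?hit \<alpha> y q" using y(3) q(1) by auto
        ultimately show False using elim(2) by blast
      qed
    qed
  qed
qed

end

section \<open>The set of injective observables is Borel\<close>

lemma sigma_compact_approx:
  fixes M :: "'a::polish_space measure"
  assumes s: "sets M = sets borel" and fin: "finite_measure M" and E: "E \<in> sets borel"
  obtains K :: "nat \<Rightarrow> 'a set" where "\<And>n. compact (K n)" "\<And>n. K n \<subseteq> E"
    "emeasure M (E - (\<Union>n. K n)) = 0"
proof -
  have "\<forall>n. \<exists>K. compact K \<and> K \<subseteq> E \<and> emeasure M (E - K) < ennreal (1 / real (Suc n))"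
    using compact_approx[OF s fin E] by simp
  then obtain K where K: "\<And>n. compact (K n)" "\<And>n. K n \<subseteq> E"
      "\<And>n. emeasure M (E - K n) < ennreal (1 / real (Suc n))"
    by metis
  have "emeasure M (E - (\<Union>n. K n)) \<le> ennreal (1 / real (Suc n))" for n
  proof -
    have "emeasure M (E - (\<Union>n. K n)) \<le> emeasure M (E - K n)"
      using E K(1)[of n] by (intro emeasure_mono) (auto simp: s borel_compact)
    then show ?thesis using K(3)[of n] by simp
  qed
  moreover have "(\<lambda>m. ennreal (1 / real (Suc m))) \<longlonglongrightarrow> ennreal 0"
    by (intro tendsto_ennrealI LIMSEQ_Suc[OF lim_1_over_n])
  ultimately have "emeasure M (E - (\<Union>n. K n)) \<le> ennreal 0"
    by (intro LIMSEQ_le_const) auto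
  with K(1,2) show thesis by (intro that[of K]) auto
qed

lemma abs_le_Lip_norm:
  assumes "compact X" "h \<in> Lip_space X" "x \<in> X"
  shows "\<bar>h x\<bar> \<le> Lip_norm X h"
proof -
  have "\<bar>h x\<bar> \<le> (SUP x\<in>X. \<bar>h x\<bar>)"
    using assms(3) Lip_space_bdd[OF assms(1,2)] by (rule cSUP_upper)
  moreover have "0 \<le> Lip_const X h"
    using Lip_const_lipschitz_on[OF assms(2)] by (rule lipschitz_on_nonneg)
  ultimately show ?thesis by (simp add: Lip_norm_def)
qed

lemma Lip_space_continuous_on: "h \<in> Lip_space X \<Longrightarrow> continuous_on X h"
  using Lip_const_lipschitz_on lipschitz_on_continuous_on by blast

lemma (in bump_family) continuous_on_probe: "continuous_on (X \<times> UNIV) (\<lambda>(x, \<alpha>). probe X \<alpha> x)"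
proof -
  have "continuous_on (X \<times> UNIV) (\<lambda>w. \<Sum>j. clip (snd w j) * p j (fst w))"
  proof (rule uniform_limit_theorem)
    show "uniform_limit (X \<times> UNIV) (\<lambda>n w. \<Sum>j<n. clip (snd w j) * p j (fst w))
        (\<lambda>w. \<Sum>j. clip (snd w j) * p j (fst w)) sequentially"
    proof (rule Weierstrass_m_test[of _ _ "\<lambda>j. (1/2) ^ j"])
      fix j and w :: "'a \<times> (nat \<Rightarrow> real)"
      show "norm (clip (snd w j) * p j (fst w)) \<le> (1/2) ^ j"
        using mult_mono[OF abs_clip_le[of "snd w j"] p_bound[of j "fst w"]] by (simp add: abs_mult)
    qed simp
    have "continuous_on (X \<times> UNIV) (\<lambda>w. p j (fst w))" for j
      by (rule continuous_on_compose2[OF lipschitz_on_continuous_on[OF p_lipschitz]])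
        (auto intro: continuous_on_fst continuous_on_id)
    moreover have "continuous_on (X \<times> UNIV) (\<lambda>w :: 'a \<times> (nat \<Rightarrow> real). snd w j)" for j
      by (rule continuous_on_compose2[OF continuous_on_product_coordinates])
        (auto intro: continuous_on_snd continuous_on_id)
    ultimately show "\<forall>\<^sub>F n in sequentially. continuous_on (X \<times> UNIV)
        (\<lambda>w. \<Sum>j<n. clip (snd w j) * p j (fst w))"
      by (intro always_eventually allI continuous_on_sum continuous_on_mult continuous_on_clip)
  qed simp
  moreover have "(case w of (x, \<alpha>) \<Rightarrow> probe X \<alpha> x) = (\<Sum>j. clip (snd w j) * p j (fst w))"
    if "w \<in> X \<times> UNIV" for w
    using that by (auto simp: probe_def)
  ultimately show ?thesis by (simp cong: continuous_on_cong)
qed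

text \<open>All conditions are closed and \<open>y\<close> ranges over a set that will be compact,
  so the existential quantifier preserves closedness. A positive \<open>d\<close> is a closed
  substitute for \<open>y \<noteq> x\<close>; a positive \<open>\<delta>\<close> leaves room for
  perturbing \<open>h\<close>.\<close>

definition near_collisions ::
    "('a::metric_space \<Rightarrow> 'a) \<Rightarrow> nat \<Rightarrow> 'a set \<Rightarrow> 'a set \<Rightarrow> real \<Rightarrow> real \<Rightarrow> ('a \<Rightarrow> real) \<Rightarrow> 'a set" where
  "near_collisions T k X K d \<delta> h =
    {x \<in> X. \<exists>y\<in>K. d \<le> dist x y \<and> (\<forall>i<k. \<bar>h ((T ^^ i) x) - h ((T ^^ i) y)\<bar> \<le> \<delta>)}"

lemma continuous_on_funpow:
  assumes "T \<in> X \<rightarrow> X" "continuous_on X T"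
  shows "continuous_on X (T ^^ i)"
proof (induction i)
  case 0
  show ?case by (simp add: continuous_on_id id_def)
next
  case (Suc i)
  have "continuous_on X (T \<circ> (T ^^ i))"
    using funpow_in[OF assms(1)]
    by (intro continuous_on_compose Suc continuous_on_subset[OF assms(2)]) auto
  then show ?case by (simp only: funpow.simps)
qed

text \<open>Projection along a compact factor is a closed map. The parameter space is arbitrary, to
  serve both coefficient sequences in Fubini's theorem and a single observable with a dummy
  parameter.\<close>

lemma closed_near_collisions:
  fixes H :: "'p::topological_space \<Rightarrow> 'a::metric_space \<Rightarrow> real"
  assumes X: "compact X" and T: "T \<in> X \<rightarrow> X" "continuous_on X T"
    and K: "compact K" "K \<subseteq> X" and H: "continuous_on (X \<times> UNIV) (\<lambda>(x, \<alpha>). H \<alpha> x)"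
  shows "closed {(x, \<alpha>). x \<in> near_collisions T k X K d \<delta> (H \<alpha>)}"
proof -
  let ?D = "K \<times> (X \<times> (UNIV :: 'p set))"
  have D: "closed ?D" using X K by (intro closed_Times compact_imp_closed closed_UNIV)
  have Ti: "continuous_on S (\<lambda>w. (T ^^ i) (f w))"
    if "continuous_on S f" "f ` S \<subseteq> X" for i S and f :: "'a \<times> 'a \<times> 'p \<Rightarrow> 'a"
    by (rule continuous_on_compose2[OF continuous_on_funpow[OF T] that])
  have H': "continuous_on ?D (\<lambda>w. H (snd (snd w)) ((T ^^ i) (f w)))"
    if "continuous_on ?D f" "f ` ?D \<subseteq> X" for i f
  proof -
    have "continuous_on ?D (\<lambda>w. case ((T ^^ i) (f w), snd (snd w)) of (x, \<alpha>) \<Rightarrow> H \<alpha> x)"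
      by (rule continuous_on_compose2[OF H])
        (use that funpow_in[OF T(1)] in \<open>auto intro!: continuous_intros Ti\<close>)
    then show ?thesis by simp
  qed
  \<comment> \<open>The quantified point \<open>y\<close> is the first component of the triple, so
    that \<open>snd\<close> projects it away.\<close>
  define U where "U = (?D \<inter> (\<lambda>w. dist (fst (snd w)) (fst w)) -` {d..}) \<inter>
    (\<Inter>i\<in>{..<k}. ?D \<inter> (\<lambda>w. \<bar>H (snd (snd w)) ((T ^^ i) (fst (snd w))) - H (snd (snd w)) ((T ^^ i) (fst w))\<bar>) -` {..\<delta>})"
  have c1: "closed (?D \<inter> (\<lambda>w. dist (fst (snd w)) (fst w)) -` {d..})"
    by (intro continuous_closed_preimage D continuous_intros)
  have c2: "closed (?D \<inter> (\<lambda>w. \<bar>H (snd (snd w)) ((T ^^ i) (fst (snd w))) - H (snd (snd w)) ((T ^^ i) (fst w))\<bar>) -` {..\<delta>})" for i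
    using K(2) by (intro continuous_closed_preimage D continuous_on_rabs continuous_on_diff H')
      (auto intro!: continuous_intros)
  have "closed U" unfolding U_def by (rule closed_Int[OF c1 closed_INT]) (use c2 in blast)
  moreover have "U \<subseteq> K \<times> UNIV" by (auto simp: U_def)
  ultimately have "closedin (top_of_set (K \<times> UNIV)) U" by (rule closed_subset[rotated])
  then have "closedin (prod_topology (top_of_set K) (euclidean :: ('a \<times> 'p) topology)) U"
    using prod_topology_subtopology_eu[of K "UNIV :: ('a \<times> 'p) set"] by simp
  moreover have "closed_map (prod_topology (top_of_set K) (euclidean :: ('a \<times> 'p) topology)) euclidean snd"
    using K(1) by (intro Abstract_Topological_Spaces.closed_map_snd) (simp add: compact_space_subtopology)
  ultimately have "closed (snd ` U)" by (simp add: closed_map_def)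
  also have "snd ` U = {(x, \<alpha>). x \<in> near_collisions T k X K d \<delta> (H \<alpha>)}"
    by (force simp: U_def near_collisions_def)
  finally show ?thesis .
qed

lemma closed_near_collisions_section:
  assumes "compact X" "T \<in> X \<rightarrow> X" "continuous_on X T" "compact K" "K \<subseteq> X" "continuous_on X h"
  shows "closed (near_collisions T k X K d \<delta> h)"
proof -
  have "continuous_on (X \<times> (UNIV :: real set)) (\<lambda>(x, \<alpha>). h x)"
    unfolding case_prod_beta
    by (rule continuous_on_compose2[OF assms(6)]) (auto intro: continuous_on_fst continuous_on_id)
  from closed_near_collisions[OF assms(1-5), of "\<lambda>_. h", OF this, of k d \<delta>]
  have "closed ((\<lambda>x. (x, 0::real)) -` {(x, \<alpha>). x \<in> near_collisions T k X K d \<delta> h})"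
    by (rule closed_vimage) (intro continuous_intros)
  then show ?thesis by (simp add: vimage_def)
qed

text \<open>The total discrepancy attains its minimum over the admissible \<open>y\<close>, a
  compact set. Near collisions at tolerance 1/(l+1) bound the minimum by k/(l+1) for every l, so the
  minimizer is an exact collision.\<close>

lemma near_collisions_Inter:
  assumes T: "T \<in> X \<rightarrow> X" "continuous_on X T" and K: "compact K" "K \<subseteq> X" and h: "continuous_on X h"
  shows "(\<Inter>l. near_collisions T k X K d (1 / real (Suc l)) h) = near_collisions T k X K d 0 h"
proof
  show "near_collisions T k X K d 0 h \<subseteq> (\<Inter>l. near_collisions T k X K d (1 / real (Suc l)) h)"
  proof (rule INT_greatest)
    fix l
    have "0 \<le> 1 / real (Suc l)" by simp
    then show "near_collisions T k X K d 0 h \<subseteq> near_collisions T k X K d (1 / real (Suc l)) h"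
      unfolding near_collisions_def using order_trans by blast
  qed
  show "(\<Inter>l. near_collisions T k X K d (1 / real (Suc l)) h) \<subseteq> near_collisions T k X K d 0 h"
  proof
    fix x assume x: "x \<in> (\<Inter>l. near_collisions T k X K d (1 / real (Suc l)) h)"
    then have xX: "x \<in> X" by (auto simp: near_collisions_def)
    define f where "f y = (\<Sum>i<k. \<bar>h ((T ^^ i) x) - h ((T ^^ i) y)\<bar>)" for y
    let ?K = "K \<inter> {y. d \<le> dist x y}"
    have y: "\<exists>y\<in>?K. f y \<le> real k * (1 / real (Suc l))" for l
    proof -
      from x obtain y where y: "y \<in> K" "d \<le> dist x y"
          "\<And>i. i < k \<Longrightarrow> \<bar>h ((T ^^ i) x) - h ((T ^^ i) y)\<bar> \<le> 1 / real (Suc l)"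
        unfolding near_collisions_def by blast
      have "f y \<le> (\<Sum>i<k. 1 / real (Suc l))" unfolding f_def using y(3) by (intro sum_mono) auto
      with y(1,2) show ?thesis by (intro bexI[of _ y]) auto
    qed
    have "closed {y. d \<le> dist x y}" by (intro closed_Collect_le continuous_intros)
    then have "compact ?K" using K(1) by (rule compact_Int_closed[rotated])
    moreover have "?K \<noteq> {}" using y[of 0] by blast
    moreover have "continuous_on ?K f"
    proof -
      have "continuous_on X (\<lambda>y. h ((T ^^ i) y))" for i
        using funpow_in[OF T(1)] by (intro continuous_on_compose2[OF h continuous_on_funpow[OF T]]) auto
      then have "continuous_on X f" unfolding f_def by (intro continuous_intros)
      then show ?thesis by (rule continuous_on_subset) (use K(2) in auto)
    qed
    ultimately have "\<exists>y0\<in>?K. \<forall>y\<in>?K. f y0 \<le> f y" by (rule continuous_attains_inf)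
    then obtain y0 where y0: "y0 \<in> ?K" "\<And>y. y \<in> ?K \<Longrightarrow> f y0 \<le> f y" by (elim bexE) blast
    have "f y0 \<le> real k * 0"
    proof (rule LIMSEQ_le_const)
      show "(\<lambda>l. real k * (1 / real (Suc l))) \<longlonglongrightarrow> real k * 0"
        by (intro tendsto_mult tendsto_const LIMSEQ_Suc[OF lim_1_over_n])
      show "\<exists>N. \<forall>l\<ge>N. f y0 \<le> real k * (1 / real (Suc l))"
      proof (intro exI allI impI)
        fix l
        from y[of l] obtain z where "z \<in> ?K" "f z \<le> real k * (1 / real (Suc l))" by blast
        with y0(2)[of z] show "f y0 \<le> real k * (1 / real (Suc l))" by linarith
      qed
    qed
    moreover have "\<bar>h ((T ^^ i) x) - h ((T ^^ i) y0)\<bar> \<le> f y0" if "i < k" for i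
      unfolding f_def using that by (intro member_le_sum) auto
    ultimately show "x \<in> near_collisions T k X K d 0 h"
      using y0(1) xX by (force simp: near_collisions_def)
  qed
qed

text \<open>Near collisions decrease to exact ones, so by continuity from above some tolerance
  already has measure below \<open>c\<close>. An observable closer than half that tolerance in
  supremum norm has all its exact collisions among these.\<close>

lemma openin_near_collisions_less:
  fixes M :: "'a::metric_space measure"
  assumes s: "sets M = sets borel" and fin: "finite_measure M"
    and X: "compact X" "X \<noteq> {}" and T: "T \<in> X \<rightarrow> X" "continuous_on X T"
    and K: "compact K" "K \<subseteq> X" and v: "v \<in> Lip_space X"
  shows "openin (norm_topology (Lip_space X) (Lip_norm X))
    {e \<in> Lip_space X. emeasure M (near_collisions T k X K d 0 (v + e)) < c}"
proof -
  interpret finite_measure M by fact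
  interpret V: Metric_space "Lip_space X" "norm_dist (Lip_space X) (Lip_norm X)"
    by (rule Metric_space_Lip_space[OF X])
  let ?C = "near_collisions T k X K d"
  have "\<exists>r>0. V.mball e0 r \<subseteq> {e \<in> Lip_space X. emeasure M (?C 0 (v + e)) < c}"
    if e0: "e0 \<in> Lip_space X" "emeasure M (?C 0 (v + e0)) < c" for e0
  proof -
    have cont: "continuous_on X (v + e0)"
      using Lip_space_add[OF v e0(1)] by (rule Lip_space_continuous_on)
    have Cs: "?C \<delta> (v + e0) \<in> sets M" for \<delta>
      unfolding s by (intro borel_closed closed_near_collisions_section X T K cont)
    have "decseq (\<lambda>l. ?C (1 / real (Suc l)) (v + e0))"
    proof (rule decseq_SucI)
      fix l
      have "1 / real (Suc (Suc l)) \<le> 1 / real (Suc l)" by (simp add: frac_le)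
      then show "?C (1 / real (Suc (Suc l))) (v + e0) \<subseteq> ?C (1 / real (Suc l)) (v + e0)"
        unfolding near_collisions_def using order_trans by blast
    qed
    then have "(INF l. emeasure M (?C (1 / real (Suc l)) (v + e0))) =
        emeasure M (\<Inter>l. ?C (1 / real (Suc l)) (v + e0))"
      using Cs by (intro INF_emeasure_decseq) auto
    also note near_collisions_Inter[OF T K cont]
    finally have "(INF l. emeasure M (?C (1 / real (Suc l)) (v + e0))) < c" using e0(2) by (simp only:)
    then obtain l where l: "emeasure M (?C (1 / real (Suc l)) (v + e0)) < c"
      unfolding INF_less_iff by blast
    define r where "r = 1 / real (Suc l) / 2"
    have "0 < r" by (simp add: r_def)
    moreover have "emeasure M (?C 0 (v + e)) < c" if e: "e \<in> V.mball e0 r" for e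
    proof -
      have eV: "e \<in> Lip_space X" and n: "Lip_norm X (e0 - e) < r"
        using e e0(1) by (auto simp: norm_dist_def)
      have close: "\<bar>e0 x - e x\<bar> \<le> r" if "x \<in> X" for x
        using abs_le_Lip_norm[OF X(1) Lip_space_diff[OF e0(1) eV] that] n by simp
      have "?C 0 (v + e) \<subseteq> ?C (1 / real (Suc l)) (v + e0)"
      proof
        fix x assume "x \<in> ?C 0 (v + e)"
        then obtain y where y: "x \<in> X" "y \<in> K" "d \<le> dist x y"
            "\<And>i. i < k \<Longrightarrow> \<bar>(v + e) ((T ^^ i) x) - (v + e) ((T ^^ i) y)\<bar> \<le> 0"
          unfolding near_collisions_def by blast
        have "\<bar>(v + e0) ((T ^^ i) x) - (v + e0) ((T ^^ i) y)\<bar> \<le> 1 / real (Suc l)" if "i < k" for i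
        proof -
          have "(T ^^ i) x \<in> X" "(T ^^ i) y \<in> X" using y K(2) by (auto intro!: funpow_in[OF T(1)])
          then have "\<bar>e0 ((T ^^ i) x) - e ((T ^^ i) x)\<bar> \<le> r" "\<bar>e0 ((T ^^ i) y) - e ((T ^^ i) y)\<bar> \<le> r"
            using close by auto
          moreover have "r + r = 1 / real (Suc l)" unfolding r_def by (rule field_sum_of_halves)
          moreover have "v ((T ^^ i) x) + e ((T ^^ i) x) = v ((T ^^ i) y) + e ((T ^^ i) y)"
            using y(4)[OF that] by simp
          ultimately show ?thesis unfolding plus_fun_apply by linarith
        qed
        with y(1-3) show "x \<in> ?C (1 / real (Suc l)) (v + e0)"
          unfolding near_collisions_def by blast
      qed
      then have "emeasure M (?C 0 (v + e)) \<le> emeasure M (?C (1 / real (Suc l)) (v + e0))"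
        using Cs by (rule emeasure_mono)
      with l show ?thesis by simp
    qed
    ultimately show ?thesis by (intro exI[of _ r]) auto
  qed
  then show ?thesis unfolding norm_topology_def V.openin_mtopology by blast
qed

text \<open>Says that \<open>M\<close>-almost every point shares its delay vector with no other
  point of the union of the \<open>K n\<close>. Countably many closed collision sets express this,
  which is what makes the set Borel.\<close>

definition injective_observables ::
    "'a::metric_space measure \<Rightarrow> ('a \<Rightarrow> 'a) \<Rightarrow> nat \<Rightarrow> 'a set \<Rightarrow> (nat \<Rightarrow> 'a set) \<Rightarrow> ('a \<Rightarrow> real) set" where
  "injective_observables M T k X K = {h \<in> Lip_space X. \<forall>n m.
     emeasure M (near_collisions T k X (K n) (1 / real (Suc m)) 0 h) = 0}"

lemma injective_observables_translate_sets:
  fixes M :: "'a::metric_space measure"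
  assumes s: "sets M = sets borel" and fin: "finite_measure M"
    and X: "compact X" "X \<noteq> {}" and T: "T \<in> X \<rightarrow> X" "continuous_on X T"
    and K: "\<And>n. compact (K n)" "\<And>n. K n \<subseteq> X" and v: "v \<in> Lip_space X"
  shows "{e \<in> Lip_space X. v + e \<in> injective_observables M T k X K}
    \<in> sets (norm_borel (Lip_space X) (Lip_norm X))"
proof -
  let ?V = "Lip_space X"
  interpret V: Metric_space ?V "norm_dist ?V (Lip_norm X)"
    by (rule Metric_space_Lip_space[OF X])
  have gen: "{U. openin (norm_topology ?V (Lip_norm X)) U} \<subseteq> Pow ?V"
    unfolding norm_topology_def using openin_subset by fastforce
  define S where "S n m l = {e \<in> ?V.
    emeasure M (near_collisions T k X (K n) (1 / real (Suc m)) 0 (v + e)) < ennreal (1 / real (Suc l))}"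
    for n m l
  have "S n m l \<in> sets (norm_borel ?V (Lip_norm X))" for n m l
    using openin_near_collisions_less[OF s fin X T K v]
    unfolding S_def norm_borel_def by (simp add: sets_measure_of[OF gen] sigma_sets.Basic)
  then have "(\<Inter>n. \<Inter>m. \<Inter>l. S n m l) \<in> sets (norm_borel ?V (Lip_norm X))"
    by (intro sets.countable_INT) auto
  also have "(\<Inter>n. \<Inter>m. \<Inter>l. S n m l) = {e \<in> ?V. v + e \<in> injective_observables M T k X K}"
  proof -
    have zero: "c = 0" if "\<And>l. c < ennreal (1 / real (Suc l))" for c
    proof -
      have "(\<lambda>l. ennreal (1 / real (Suc l))) \<longlonglongrightarrow> ennreal 0"
        by (intro tendsto_ennrealI LIMSEQ_Suc[OF lim_1_over_n])
      then have "c \<le> ennreal 0"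
        by (rule LIMSEQ_le_const) (use that less_imp_le in blast)
      then show ?thesis by simp
    qed
    show ?thesis
      using zero Lip_space_add[OF v] unfolding injective_observables_def S_def
      by (auto simp del: of_nat_Suc)
  qed
  finally show ?thesis .
qed

text \<open>\<open>AE_no_collision\<close> treats one \<open>x\<close> at a time, with exceptional
  coefficients depending on \<open>x\<close>. Joint closedness of the collision relation supplies
  the measurability for exchanging the two almost-everywhere quantifiers.\<close>

lemma AE_injective_observables:
  fixes M :: "'a::polish_space measure"
  assumes bf: "bump_family p c" and s: "sets M = sets borel" and fin: "finite_measure M" and M: "AE x in M. x \<in> X"
    and X: "compact X" and T: "T \<in> X \<rightarrow> X" "inj_on T X" "L-lipschitz_on X T"
    and K: "\<And>n. compact (K n)" "\<And>n. K n \<subseteq> X"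
    and nul: "1 \<le> k" "null_cover k (\<Union>n. K n)"
      "\<And>q. q \<in> {1..<k} \<Longrightarrow> null_cover q ((\<Union>n. K n) \<inter> Per q T X)"
    and v: "v \<in> Lip_space X"
  shows "AE \<alpha> in cube_measure. v + bump_family.probe p X \<alpha> \<in> injective_observables M T k X K"
proof -
  interpret bump_family p c by (rule bf)
  interpret M: finite_measure M by (rule fin)
  interpret P: prob_space cube_measure by (rule prob_space_cube)
  interpret pair_sigma_finite M cube_measure ..
  let ?C = "\<lambda>n m \<alpha>. near_collisions T k X (K n) (1 / real (Suc m)) 0 (v + probe X \<alpha>)"
  have Tc: "continuous_on X T" using T(3) by (rule lipschitz_on_continuous_on)
  have vc: "continuous_on (X \<times> UNIV) (\<lambda>(x, \<alpha>). (v + probe X \<alpha>) x)"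
  proof -
    have "continuous_on (X \<times> (UNIV :: (nat \<Rightarrow> real) set)) (\<lambda>w. v (fst w))"
      by (rule continuous_on_compose2[OF Lip_space_continuous_on[OF v]])
        (auto intro: continuous_on_fst continuous_on_id)
    from continuous_on_add[OF this continuous_on_probe] show ?thesis
      by (simp add: case_prod_beta)
  qed
  have spM: "space M = UNIV" using sets_eq_imp_space_eq[OF s] by simp
  have spP: "space cube_measure = UNIV" using sets_eq_imp_space_eq[OF sets_cube] by simp
  have "AE \<alpha> in cube_measure. emeasure M (?C n m \<alpha>) = 0" for n m
  proof -
    have cl: "closed {(x, \<alpha>). x \<in> ?C n m \<alpha>}"
      by (rule closed_near_collisions[OF X T(1) Tc K vc])
    have "sets (M \<Otimes>\<^sub>M cube_measure) = sets borel"
      unfolding borel_prod[symmetric] by (rule sets_pair_measure_cong[OF s sets_cube])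
    moreover have "{w \<in> space (M \<Otimes>\<^sub>M cube_measure). fst w \<notin> ?C n m (snd w)} =
        - {(x, \<alpha>). x \<in> ?C n m \<alpha>}"
      by (auto simp: space_pair_measure spM spP)
    ultimately have Z: "{w \<in> space (M \<Otimes>\<^sub>M cube_measure). fst w \<notin> ?C n m (snd w)}
        \<in> sets (M \<Otimes>\<^sub>M cube_measure)"
      using borel_comp[OF borel_closed[OF cl]] by (simp only:)
    have "AE x in M. AE \<alpha> in cube_measure. x \<notin> ?C n m \<alpha>"
      using M
    proof eventually_elim
      case (elim x)
      have "AE \<alpha> in cube_measure. \<not> (\<exists>y\<in>(\<Union>n. K n). y \<noteq> x \<and> (\<forall>i<k.
          (v + probe X \<alpha>) ((T ^^ i) x) = (v + probe X \<alpha>) ((T ^^ i) y)))"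
        by (rule AE_no_collision[OF T v elim nul(1) _ nul(2,3)]) (use K(2) in blast)
      then show ?case
      proof eventually_elim
        case (elim \<alpha>)
        show ?case
        proof
          assume "x \<in> ?C n m \<alpha>"
          then obtain y where y: "y \<in> K n" "1 / real (Suc m) \<le> dist x y"
              "\<And>i. i < k \<Longrightarrow> \<bar>(v + probe X \<alpha>) ((T ^^ i) x) - (v + probe X \<alpha>) ((T ^^ i) y)\<bar> \<le> 0"
            unfolding near_collisions_def by blast
          have "0 < 1 / real (Suc m)" by simp
          with y(2) have "y \<noteq> x" by auto
          moreover have "(v + probe X \<alpha>) ((T ^^ i) x) = (v + probe X \<alpha>) ((T ^^ i) y)" if "i < k" for i
            using y(3)[OF that] by simp
          ultimately show False using elim y(1) by blast
        qed
      qed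
    qed
    then have "AE \<alpha> in cube_measure. AE x in M. x \<notin> ?C n m \<alpha>"
      by (rule AE_commute[OF Z, THEN iffD1])
    then show ?thesis
    proof eventually_elim
      case (elim \<alpha>)
      have "closed (?C n m \<alpha>)"
        by (rule closed_near_collisions_section[OF X T(1) Tc K])
          (rule Lip_space_continuous_on[OF Lip_space_add[OF v probe_in_Lip_space]])
      then have "?C n m \<alpha> \<in> sets M" by (simp add: s borel_closed)
      with elim show ?case by (simp add: AE_iff_measurable[OF _ refl] spM)
    qed
  qed
  then have "AE \<alpha> in cube_measure. \<forall>n m. emeasure M (?C n m \<alpha>) = 0"
    by (simp only: AE_all_countable) blast
  then show ?thesis
    by eventually_elim
      (simp add: injective_observables_def Lip_space_add[OF v probe_in_Lip_space] del: of_nat_Suc)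
qed

text \<open>Removing the null set \<open>N\<close> of colliding points suffices: of two colliding
  points, one would have to lie in \<open>N\<close>.\<close>

lemma injective_observables_imp_injective:
  fixes M :: "'a::metric_space measure"
  assumes s: "sets M = sets borel" and X: "compact X" and T: "T \<in> X \<rightarrow> X" "continuous_on X T"
    and K: "\<And>n :: nat. compact (K n)" "\<And>n. K n \<subseteq> X" "AE x in M. x \<in> (\<Union>n. K n)"
    and h: "h \<in> injective_observables M T k X K"
  obtains G where "G \<in> sets borel" "G \<subseteq> X" "AE x in M. x \<in> G"
    "\<And>x y. x \<in> G \<Longrightarrow> y \<in> G \<Longrightarrow> (\<And>i. i < k \<Longrightarrow> h ((T ^^ i) x) = h ((T ^^ i) y)) \<Longrightarrow> x = y"
proof -
  let ?C = "\<lambda>n m. near_collisions T k X (K n) (1 / real (Suc m)) 0 h"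
  define N where "N = (\<Union>n. \<Union>m. ?C n m)"
  have hL: "h \<in> Lip_space X" and z: "\<And>n m. emeasure M (?C n m) = 0"
    using h unfolding injective_observables_def by blast+
  have cl: "closed (?C n m)" for n m
    by (rule closed_near_collisions_section[OF X T K(1,2) Lip_space_continuous_on[OF hL]])
  then have "?C n m \<in> null_sets M" for n m
    using z by (intro null_setsI) (auto simp: s borel_closed)
  then have N: "N \<in> null_sets M"
    unfolding N_def by (intro null_sets_UN)
  have Kb: "(\<Union>n. K n) \<in> sets borel" using K(1) by (intro sets.countable_UN) (auto simp: borel_compact)
  show thesis
  proof (rule that[of "(\<Union>n. K n) - N"])
    show "(\<Union>n. K n) - N \<in> sets borel" using Kb N by (auto simp: s)
    show "(\<Union>n. K n) - N \<subseteq> X" using K(2) by blast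
    show "AE x in M. x \<in> (\<Union>n. K n) - N"
      using K(3) AE_not_in[OF N] by eventually_elim blast
    fix x y assume x: "x \<in> (\<Union>n. K n) - N" and y: "y \<in> (\<Union>n. K n) - N"
      and eq: "\<And>i. i < k \<Longrightarrow> h ((T ^^ i) x) = h ((T ^^ i) y)"
    show "x = y"
    proof (rule ccontr)
      assume "x \<noteq> y"
      then obtain m where "1 / real (Suc m) < dist x y" using nat_approx_posE[of "dist x y"] by auto
      moreover from y obtain n where "y \<in> K n" by blast
      moreover have "x \<in> X" using x K(2) by blast
      ultimately have "x \<in> ?C n m"
        unfolding near_collisions_def using eq by (auto intro!: bexI[of _ y] less_imp_le)
      then show False using x unfolding N_def by blast
    qed
  qed
qed

section \<open>Delay maps and assembly of the theorem\<close>

lemma delay_map_eq_iff: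
  assumes "bij_betw idx UNIV {..<k}"
  shows "delay_map idx T h x = delay_map idx T h y \<longleftrightarrow> (\<forall>i<k. h ((T ^^ i) x) = h ((T ^^ i) y))"
proof -
  have "delay_map idx T h x = delay_map idx T h y \<longleftrightarrow>
      (\<forall>i\<in>range idx. h ((T ^^ i) x) = h ((T ^^ i) y))"
    by (simp add: delay_map_def vec_eq_iff)
  also have "range idx = {..<k}" using assms by (simp add: bij_betw_def)
  finally show ?thesis by auto
qed

lemma continuous_on_delay_map:
  assumes "T \<in> X \<rightarrow> X" "continuous_on X T" "continuous_on X h"
  shows "continuous_on X (delay_map idx T h)"
  unfolding delay_map_def
  using funpow_in[OF assms(1)]
  by (intro continuous_on_vec_lambda continuous_on_compose2[OF assms(3) continuous_on_funpow[OF assms(1,2)]]) auto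

theorem theorem1p7:
  fixes X :: "(real ^ 'n) set"
    and \<mu> :: "(real ^ 'n) measure"
    and T :: "real ^ 'n \<Rightarrow> real ^ 'n"
    and k :: nat
    and idx :: "'k::finite \<Rightarrow> nat"
  assumes "compact X"
    and "prob_space \<mu>" and "sets \<mu> = sets (restrict_space borel X)"
    and "T \<in> X \<rightarrow> X" and "inj_on T X" and "\<exists>L. L-lipschitz_on X T"
    and "bij_betw idx UNIV {..<k}"
    and "hausdorff_dim_measure \<mu> < ereal (real k)"
    and "\<forall>p\<in>{1..<k}. hausdorff_dim_measure (restrict_space \<mu> (Per p T X)) < ereal (real p)"
  shows "prevalent (Lip_space X) (Lip_norm X)
    {h \<in> Lip_space X.
       (\<exists>A \<in> sets \<mu>. emeasure \<mu> A = 1 \<and> inj_on (delay_map idx T h) A) \<and>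
       (AE y in distr \<mu> borel (delay_map idx T h). predictable \<mu> T (delay_map idx T h) y)}"
proof -
  note X = assms(1) and sets\<mu> = assms(3) and T = assms(4,5) and idx = assms(7)
  interpret prob_space \<mu> by (rule assms(2))
  from assms(6) obtain L where L: "L-lipschitz_on X T" by blast
  have Tc: "continuous_on X T" using L by (rule lipschitz_on_continuous_on)
  have space: "space \<mu> = X"
    using sets_eq_imp_space_eq[OF sets\<mu>] by (simp add: space_restrict_space)
  have ne: "X \<noteq> {}" using not_empty space by simp
  have Xb: "X \<in> sets borel" using X by (rule borel_compact)
  have k: "1 \<le> k" using idx by (cases k) (auto simp: bij_betw_def)
  have in_sets: "B \<inter> X \<in> sets \<mu>" if "B \<in> sets borel" for B
    using that by (auto simp: sets\<mu> sets_restrict_space)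
  have id_meas: "(\<lambda>x. x) \<in> measurable \<mu> borel"
    using in_sets by (intro measurableI) (auto simp: space vimage_def Int_commute)
  \<comment> \<open>\<open>\<mu>\<close> lives on the subspace \<open>X\<close>; its image under the
    inclusion is a Borel measure on the whole Polish space, as inner regularity requires.\<close>
  define M where "M = distr \<mu> borel (\<lambda>x. x)"
  have sM: "sets M = sets borel" by (simp add: M_def)
  interpret M: prob_space M unfolding M_def by (rule prob_space_distr[OF id_meas])
  have fin: "finite_measure M" by unfold_locales
  have spM: "space M = UNIV" by (simp add: M_def)
  have em: "emeasure M B = emeasure \<mu> (B \<inter> X)" if "B \<in> sets borel" for B
    unfolding M_def using that by (subst emeasure_distr[OF id_meas]) (auto simp: space)
  have AE_M: "AE x in M. x \<in> B" if "B \<in> sets borel" "emeasure \<mu> (X - B) = 0" for B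
    using that em[of "- B"] by (intro AE_I[of _ _ "- B"]) (auto simp: sM Int_commute Diff_eq)

  obtain A0 where A0: "A0 \<in> sets borel" "emeasure \<mu> (X - A0) = 0" "null_cover k A0"
    using null_cover_of_hausdorff_dim_measure[OF assms(8)] space by metis
  have Per: "Per p T X \<in> sets borel" "Per p T X \<in> sets \<mu>" for p
  proof -
    have "closed (Per p T X)"
    proof -
      have "continuous_on X (\<lambda>x. (T ^^ p) x - x)"
        by (intro continuous_intros continuous_on_funpow[OF T(1) Tc])
      from continuous_closed_preimage[OF this compact_imp_closed[OF X] closed_singleton[of 0]]
      show ?thesis by (simp add: Per_def vimage_def Int_def)
    qed
    then show b: "Per p T X \<in> sets borel" by (rule borel_closed)
    have "Per p T X \<inter> X = Per p T X" by (auto simp: Per_def)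
    with in_sets[OF b] show "Per p T X \<in> sets \<mu>" by simp
  qed
  have "\<exists>A. A \<in> sets borel \<and> emeasure \<mu> (Per p T X - A) = 0 \<and> null_cover p A" if "p \<in> {1..<k}" for p
  proof -
    have sp: "space (restrict_space \<mu> (Per p T X)) = Per p T X"
      by (auto simp: space_restrict_space space Per_def)
    have "hausdorff_dim_measure (restrict_space \<mu> (Per p T X)) < ereal (real p)"
      using assms(9) that by blast
    then obtain A where "A \<in> sets borel" "null_cover p A"
        "emeasure (restrict_space \<mu> (Per p T X)) (space (restrict_space \<mu> (Per p T X)) - A) = 0"
      by (rule null_cover_of_hausdorff_dim_measure)
    moreover have "emeasure (restrict_space \<mu> (Per p T X)) (Per p T X - A) = emeasure \<mu> (Per p T X - A)"
      using Per(2)[of p] by (intro emeasure_restrict_space) auto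
    ultimately show ?thesis unfolding sp by auto
  qed
  then obtain Ap where Ap: "\<And>p. p \<in> {1..<k} \<Longrightarrow> Ap p \<in> sets borel"
      "\<And>p. p \<in> {1..<k} \<Longrightarrow> emeasure \<mu> (Per p T X - Ap p) = 0"
      "\<And>p. p \<in> {1..<k} \<Longrightarrow> null_cover p (Ap p)"
    by metis
  \<comment> \<open>For each \<open>p\<close> the null part of the periodic points that escapes
    \<open>Ap p\<close> is removed, so that \<open>A\<close> meets \<open>Per p T X\<close> only
    inside \<open>Ap p\<close>.\<close>
  define A where "A = A0 \<inter> X - (\<Union>p\<in>{1..<k}. Per p T X - Ap p)"
  have A: "A \<in> sets borel" unfolding A_def using A0(1) Xb Per(1) Ap(1) by auto
  have AE_A: "AE x in M. x \<in> A"
  proof -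
    have "AE x in M. x \<in> A0" by (rule AE_M[OF A0(1,2)])
    moreover have "AE x in M. x \<in> X" by (rule AE_M[OF Xb]) simp
    moreover have "AE x in M. \<forall>p\<in>{1..<k}. x \<in> - (Per p T X - Ap p)"
    proof -
      have "AE x in M. x \<in> - (Per p T X - Ap p)" if p: "p \<in> {1..<k}" for p
      proof (rule AE_M)
        show "- (Per p T X - Ap p) \<in> sets borel" using Per(1) Ap(1)[OF p] by auto
        have "X - - (Per p T X - Ap p) = Per p T X - Ap p" by (auto simp: Per_def)
        then show "emeasure \<mu> (X - - (Per p T X - Ap p)) = 0" using Ap(2)[OF p] by simp
      qed
      then show ?thesis by (subst AE_finite_all) auto
    qed
    ultimately show ?thesis by eventually_elim (auto simp: A_def)
  qed
  obtain K where K: "\<And>n :: nat. compact (K n)" "\<And>n. K n \<subseteq> A" "emeasure M (A - (\<Union>n. K n)) = 0"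
    using sigma_compact_approx[OF sM fin A] by blast
  have KX: "K n \<subseteq> X" for n using K(2)[of n] by (auto simp: A_def)
  have AE_UN: "AE x in M. x \<in> (\<Union>n. K n)"
    if K: "\<And>n :: nat. compact (K n)" "emeasure M (B - (\<Union>n. K n)) = 0" and B: "B \<in> sets borel" "AE x in M. x \<in> B"
    for K B
  proof -
    have "B - (\<Union>n. K n) \<in> sets M"
      unfolding sM using K(1) B(1) by (auto intro!: sets.Diff sets.countable_UN simp: borel_compact)
    with K(2) have "B - (\<Union>n. K n) \<in> null_sets M" by blast
    from AE_not_in[OF this] B(2) show ?thesis by eventually_elim blast
  qed
  have AE_K: "AE x in M. x \<in> (\<Union>n. K n)" by (rule AE_UN[OF K(1,3) A AE_A])
  have nul: "null_cover k (\<Union>n. K n)"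
    by (rule null_cover_mono[OF A0(3)]) (use K(2) in \<open>auto simp: A_def\<close>)
  have nul_Per: "null_cover q ((\<Union>n. K n) \<inter> Per q T X)" if "q \<in> {1..<k}" for q
  proof (rule null_cover_mono[OF Ap(3)[OF that]])
    show "(\<Union>n. K n) \<inter> Per q T X \<subseteq> Ap q"
    proof
      fix x assume "x \<in> (\<Union>n. K n) \<inter> Per q T X"
      with K(2) have "x \<in> A" "x \<in> Per q T X" by auto
      with that show "x \<in> Ap q" unfolding A_def by blast
    qed
  qed

  let ?B = "injective_observables M T k X K"
  obtain p :: "nat \<Rightarrow> real ^ 'n \<Rightarrow> real" and c where bf: "bump_family p c"
    using ex_bump_family by blast
  have "prevalent_borel (Lip_space X) (Lip_norm X) ?B"
  proof (rule bump_family.prevalent_borelI[OF bf X ne])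
    show "{e \<in> Lip_space X. v + e \<in> ?B} \<in> sets (norm_borel (Lip_space X) (Lip_norm X))"
      if "v \<in> Lip_space X" for v
      by (rule injective_observables_translate_sets[OF sM fin X ne T(1) Tc K(1) KX that])
    show "?B \<subseteq> Lip_space X" by (auto simp: injective_observables_def)
    show "AE \<alpha> in cube_measure. v + bump_family.probe p X \<alpha> \<in> ?B" if "v \<in> Lip_space X" for v
      by (rule AE_injective_observables[OF bf sM fin _ X T L K(1) KX k nul nul_Per that])
        (rule AE_M[OF Xb], simp)
  qed
  moreover have "(\<exists>A\<in>sets \<mu>. emeasure \<mu> A = 1 \<and> inj_on (delay_map idx T h) A) \<and>
      (AE y in distr \<mu> borel (delay_map idx T h). predictable \<mu> T (delay_map idx T h) y)"
    if h: "h \<in> ?B" for h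
  proof -
    let ?\<phi> = "delay_map idx T h"
    have hc: "continuous_on X h"
      using h by (intro Lip_space_continuous_on) (simp add: injective_observables_def)
    obtain G where G: "G \<in> sets borel" "G \<subseteq> X" "AE x in M. x \<in> G"
      "\<And>x y. x \<in> G \<Longrightarrow> y \<in> G \<Longrightarrow> (\<And>i. i < k \<Longrightarrow> h ((T ^^ i) x) = h ((T ^^ i) y)) \<Longrightarrow> x = y"
      using injective_observables_imp_injective[OF sM X T(1) Tc K(1) KX AE_K h] by blast
    have inj: "inj_on ?\<phi> G"
      using G(4) by (intro inj_onI) (simp add: delay_map_eq_iff[OF idx])
    have "emeasure M G = 1"
      using G(1,3) by (intro M.emeasure_eq_1_AE) (auto simp: sM)
    then have "emeasure \<mu> G = 1" using em[OF G(1)] G(2) by (simp add: Int_absorb2)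
    moreover have "G \<in> sets \<mu>" using in_sets[OF G(1)] G(2) by (simp add: Int_absorb2)
    moreover have "AE y in distr \<mu> borel ?\<phi>. predictable \<mu> T ?\<phi> y"
    proof -
      \<comment> \<open>A second exhaustion by compact sets, now inside \<open>G\<close>:
        injectivity is known only there, and the predictability argument needs compact
        pieces.\<close>
      obtain K' where K': "\<And>n :: nat. compact (K' n)" "\<And>n. K' n \<subseteq> G" "emeasure M (G - (\<Union>n. K' n)) = 0"
        using sigma_compact_approx[OF sM fin G(1)] by blast
      have "AE x in M. x \<in> (\<Union>n. K' n)" by (rule AE_UN[OF K'(1,3) G(1,3)])
      then have "AE x in \<mu>. x \<in> (\<Union>n. K' n)"
        unfolding M_def by (rule AE_distrD[OF id_meas])
      moreover have "inj_on ?\<phi> (\<Union>n. K' n)" using inj K'(2) by (auto intro: inj_on_subset)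
      moreover have "K' n \<subseteq> X" for n using K'(2) G(2) by blast
      ultimately show ?thesis
        using K'(1) by (intro AE_predictable[OF X _ sets\<mu> continuous_on_delay_map[OF T(1) Tc hc] T(1) Tc, of K'])
          (auto intro: finite_measure_axioms)
    qed
    ultimately show ?thesis using inj by blast
  qed
  moreover have "?B \<subseteq> Lip_space X" by (auto simp: injective_observables_def)
  ultimately show ?thesis unfolding prevalent_iff by blast
qed

end
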